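(* Let $A$ be a type and $t$ a $\lambda\mu$-term. Then $t \in |A|$ if and only if there exists a closed term $t'$ such that $t \triangleright^* t'$ and $\vdash t' : A$ (i.e. $t'$ is typable with type $A$ in empty contexts).
   Context: $\lambda\mu$-terms: fix two disjoint infinite sets of variables, the $\lambda$-variables ($x,y,\dots$) and the $\mu$-variables ($\alpha,\beta,\dots$). Terms are given by $t ::= x \mid \lambda x.t \mid (t\,t) \mid \mu\alpha.t \mid (\alpha\,t)$, where $\lambda x$ and $\mu\alpha$ are binders (terms are taken up to renaming of bound variables). For terms $u,v$ and a $\mu$-variable $\alpha$, $u[\alpha:=^*v]$ is obtained from $u$ by replacing inductively each subterm of the form $(\alpha\,w)$ by $(\alpha\,(w\,v))$. One-step reduction $\triangleright$ is the compatible closure of $(\lambda x.u\;v)\triangleright u[x:=v]$ and $(\mu\alpha.u\;v)\triangleright \mu\alpha.u[\alpha:=^*v]$; $\triangleright^*$ is its reflexive transitive closure. For a finite sequence $\bar u=u_1\dots u_n$ of terms, $(t\,\bar u)$ denotes $(\dots(t\,u_1)\dots u_n)$, with $(t\,\emptyset)=t$; $\mathcal{T}$ is the set of terms and $\mathcal{T}^{<\omega}$ the set of finite sequences of terms. Types: $A ::= X \mid \perp \mid A\to A$, with $X$ ranging over an infinite set $\mathcal{P}$ of propositional variables and $\perp$ a constant. Typing judgements $\Gamma\vdash t:A\,;\Delta$, with $\Gamma$ a set of declarations $x:A$ (distinct $\lambda$-variables) and $\Delta$ a set of declarations $\alpha:B$ (distinct $\mu$-variables), are derived by: (ax) $\Gamma\vdash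 x:A;\Delta$ if $x:A\in\Gamma$; ($\to_i$) from $\Gamma,x:A\vdash t:B;\Delta$ infer $\Gamma\vdash\lambda x.t:A\to B;\Delta$; ($\to_e$) from $\Gamma\vdash u:A\to B;\Delta$ and $\Gamma\vdash v:A;\Delta$ infer $\Gamma\vdash(u\,v):B;\Delta$; ($\mu$) from $\Gamma\vdash t:\perp;\Delta,\alpha:A$ infer $\Gamma\vdash\mu\alpha.t:A;\Delta$; ($\perp$) from $\Gamma\vdash t:A;\Delta,\alpha:A$ infer $\Gamma\vdash(\alpha\,t):\perp;\Delta,\alpha:A$. $\vdash t:A$ means both contexts are empty. Semantics: a set $\mathcal S$ of terms is saturated if whenever $v\triangleright^* u$ and $u\in\mathcal S$ then $v\in\mathcal S$. For sets of terms $\mathcal K,\mathcal L$, $\mathcal K\leadsto\mathcal L=\{t \mid \forall u\in\mathcal K,\ (t\,u)\in\mathcal L\}$; for $\mathcal X\subseteq\mathcal T^{<\omega}$, $\mathcal X\leadsto\mathcal L=\{t\mid \forall\bar u\in\mathcal X,\ (t\,\bar u)\in\mathcal L\}$. A model $\mathcal M=\langle(\mathcal C_i)_{i\in I},(\mathcal B_i)_{i\in I},(R_j)_{j\in J}\rangle$ consists of subsets $I,J\subseteq\mathbb N$ with $0\in I$, pairwise disjoint infinite sets $\mathcal C_i$ of $\mu$-variables, and non-empty saturated sets of terms $\mathcal B_i$, $R_j$, such that: for all $i\in I$, $\alpha\in\mathcal C_i$ and $u\in\mathcal B_0$, $\mu\alpha.u\in\mathcal B_i$; for all $i\in I$, $\alpha\in\mathcal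 C_i$ and $u\in\mathcal B_i$, $(\alpha\,u)\in\mathcal B_0$; for every $j\in J$ there are $i\in I$ and $\mathcal X_j\subseteq\mathcal T^{<\omega}$ with $R_j=\mathcal X_j\leadsto\mathcal B_i$. $|\mathcal M|$ is the smallest set of sets of terms containing all $\mathcal B_i$ and $R_j$ and closed under $\leadsto$. An $\mathcal M$-interpretation is a map $\mathcal I:\mathcal P\to|\mathcal M|$, extended by $\mathcal I(\perp)=\mathcal B_0$, $\mathcal I(A\to B)=\mathcal I(A)\leadsto\mathcal I(B)$. $|A|_{\mathcal M}=\bigcap\{\mathcal I(A)\mid \mathcal I$ an $\mathcal M$-interpretation$\}$ and $|A|=\bigcap\{|A|_{\mathcal M}\mid\mathcal M$ a model$\}$. *)

theory Defs
  imports Main "HOL-Library.Infinite_Typeclass" "HOL-Library.Disjoint_Sets"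
begin

section \<open>Terms up to renaming of bound variables\<close>

text \<open>
  Terms are represented in locally nameless style: a reference to a variable is either a free name
  or a de Bruijn index. The indices of the two kinds of binders are counted separately. A \<open>term\<close> is
  a preterm without dangling indices, so that equality of terms is alpha-equivalence, and the
  abstractions \<open>Lam x t\<close> and \<open>Mu \<alpha> t\<close> are functions which bind the name \<open>x\<close> (resp. \<open>\<alpha>\<close>) in the
  term \<open>t\<close>. The lemmas at the end of this section confirm that the type behaves as the set of named
  terms modulo renaming. The \<open>\<lambda>\<close>-variables and the \<open>\<mu>\<close>-variables are the elements of two types
  \<open>'x\<close> and \<open>'m\<close>, hence disjoint.
\<close>

datatype (names: 'v) ref = Free 'v | Bound nat
  for map: map_ref

datatype (pfv: 'x, pfmv: 'm) ptrm =
    PVar "'x ref"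
  | PLam "('x, 'm) ptrm"
  | PApp "('x, 'm) ptrm" "('x, 'm) ptrm"
  | PMu "('x, 'm) ptrm"
  | PNamed "'m ref" "('x, 'm) ptrm"
  for map: pmap

primrec below :: "nat \<Rightarrow> 'v ref \<Rightarrow> bool" where
  "below k (Free x) = True"
| "below k (Bound i) = (i < k)"

text \<open>\<open>scoped k l t\<close>: the dangling \<open>\<lambda>\<close>-indices of \<open>t\<close> are below \<open>k\<close>, its dangling \<open>\<mu>\<close>-indices
  below \<open>l\<close>.\<close>

primrec scoped :: "nat \<Rightarrow> nat \<Rightarrow> ('x, 'm) ptrm \<Rightarrow> bool" where
  "scoped k l (PVar r) = below k r"
| "scoped k l (PLam t) = scoped (Suc k) l t"
| "scoped k l (PApp t u) = (scoped k l t \<and> scoped k l u)"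
| "scoped k l (PMu t) = scoped k (Suc l) t"
| "scoped k l (PNamed r t) = (below l r \<and> scoped k l t)"

definition bind_ref :: "nat \<Rightarrow> 'v \<Rightarrow> 'v ref \<Rightarrow> 'v ref" where
  "bind_ref k x r = (if r = Free x then Bound k else r)"

primrec pbind :: "nat \<Rightarrow> 'x \<Rightarrow> ('x, 'm) ptrm \<Rightarrow> ('x, 'm) ptrm" where
  "pbind k x (PVar r) = PVar (bind_ref k x r)"
| "pbind k x (PLam t) = PLam (pbind (Suc k) x t)"
| "pbind k x (PApp t u) = PApp (pbind k x t) (pbind k x u)"
| "pbind k x (PMu t) = PMu (pbind k x t)"
| "pbind k x (PNamed r t) = PNamed r (pbind k x t)"

primrec pmbind :: "nat \<Rightarrow> 'm \<Rightarrow> ('x, 'm) ptrm \<Rightarrow> ('x, 'm) ptrm" where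
  "pmbind l \<alpha> (PVar r) = PVar r"
| "pmbind l \<alpha> (PLam t) = PLam (pmbind l \<alpha> t)"
| "pmbind l \<alpha> (PApp t u) = PApp (pmbind l \<alpha> t) (pmbind l \<alpha> u)"
| "pmbind l \<alpha> (PMu t) = PMu (pmbind (Suc l) \<alpha> t)"
| "pmbind l \<alpha> (PNamed r t) = PNamed (bind_ref l \<alpha> r) (pmbind l \<alpha> t)"

text \<open>The substitutions below are used only for \<open>v\<close> without dangling indices, so that no shifting
  is needed and no capture is possible.\<close>

primrec psubst :: "'x \<Rightarrow> ('x, 'm) ptrm \<Rightarrow> ('x, 'm) ptrm \<Rightarrow> ('x, 'm) ptrm" where
  "psubst x v (PVar r) = (if r = Free x then v else PVar r)"
| "psubst x v (PLam t) = PLam (psubst x v t)"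
| "psubst x v (PApp t u) = PApp (psubst x v t) (psubst x v u)"
| "psubst x v (PMu t) = PMu (psubst x v t)"
| "psubst x v (PNamed r t) = PNamed r (psubst x v t)"

primrec pmsubst :: "'m \<Rightarrow> ('x, 'm) ptrm \<Rightarrow> ('x, 'm) ptrm \<Rightarrow> ('x, 'm) ptrm" where
  "pmsubst \<alpha> v (PVar r) = PVar r"
| "pmsubst \<alpha> v (PLam t) = PLam (pmsubst \<alpha> v t)"
| "pmsubst \<alpha> v (PApp t u) = PApp (pmsubst \<alpha> v t) (pmsubst \<alpha> v u)"
| "pmsubst \<alpha> v (PMu t) = PMu (pmsubst \<alpha> v t)"
| "pmsubst \<alpha> v (PNamed r t) =
     PNamed r (if r = Free \<alpha> then PApp (pmsubst \<alpha> v t) v else pmsubst \<alpha> v t)"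

lemma below_mono: "below k r \<Longrightarrow> k \<le> k' \<Longrightarrow> below k' r"
  by (cases r) auto

lemma scoped_mono: "scoped k l t \<Longrightarrow> k \<le> k' \<Longrightarrow> l \<le> l' \<Longrightarrow> scoped k' l' t"
  by (induction t arbitrary: k l k' l') (auto intro: below_mono)

lemma below_bind_ref: "below k r \<Longrightarrow> below (Suc k) (bind_ref k x r)"
  by (cases r) (auto simp: bind_ref_def)

lemma scoped_pbind: "scoped k l t \<Longrightarrow> scoped (Suc k) l (pbind k x t)"
  by (induction t arbitrary: k l) (auto intro: below_bind_ref)

lemma scoped_pmbind: "scoped k l t \<Longrightarrow> scoped k (Suc l) (pmbind l \<alpha> t)"
  by (induction t arbitrary: k l) (auto intro: below_bind_ref)

lemma scoped_psubst: "scoped k l t \<Longrightarrow> scoped 0 0 v \<Longrightarrow> scoped k l (psubst x v t)"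
  by (induction t arbitrary: k l) (auto intro: scoped_mono)

lemma scoped_pmsubst: "scoped k l t \<Longrightarrow> scoped 0 0 v \<Longrightarrow> scoped k l (pmsubst \<alpha> v t)"
  by (induction t arbitrary: k l) (auto intro: scoped_mono)

lemma below_map_ref: "below k (map_ref f r) = below k r"
  by (cases r) auto

lemma scoped_pmap: "scoped k l (pmap f g t) = scoped k l t"
  by (induction t arbitrary: k l) (auto simp: below_map_ref)

typedef ('x, 'm) trm = "{t :: ('x, 'm) ptrm. scoped 0 0 t}"
  by (rule exI[of _ "PVar (Free undefined)"]) simp

setup_lifting type_definition_trm

lift_definition Var :: "'x \<Rightarrow> ('x, 'm) trm" is "\<lambda>x. PVar (Free x)"
  by simp

lift_definition Lam :: "'x \<Rightarrow> ('x, 'm) trm \<Rightarrow> ('x, 'm) trm" is "\<lambda>x t. PLam (pbind 0 x t)"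
  by (simp add: scoped_pbind)

lift_definition App :: "('x, 'm) trm \<Rightarrow> ('x, 'm) trm \<Rightarrow> ('x, 'm) trm" is PApp
  by simp

lift_definition Mu :: "'m \<Rightarrow> ('x, 'm) trm \<Rightarrow> ('x, 'm) trm" is "\<lambda>\<alpha> t. PMu (pmbind 0 \<alpha> t)"
  by (simp add: scoped_pmbind)

text \<open>\<open>Named \<alpha> t\<close> is the term \<open>(\<alpha> t)\<close>.\<close>

lift_definition Named :: "'m \<Rightarrow> ('x, 'm) trm \<Rightarrow> ('x, 'm) trm" is "\<lambda>\<alpha> t. PNamed (Free \<alpha>) t"
  by simp

lift_definition fv :: "('x, 'm) trm \<Rightarrow> 'x set" is pfv .

lift_definition fmv :: "('x, 'm) trm \<Rightarrow> 'm set" is pfmv .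

lift_definition subst :: "('x, 'm) trm \<Rightarrow> 'x \<Rightarrow> ('x, 'm) trm \<Rightarrow> ('x, 'm) trm"
    (\<open>_[_ ::= _]\<close> [300, 0, 0] 300) is "\<lambda>t x v. psubst x v t"
  by (rule scoped_psubst)

lift_definition msubst :: "('x, 'm) trm \<Rightarrow> 'm \<Rightarrow> ('x, 'm) trm \<Rightarrow> ('x, 'm) trm"
    (\<open>_[_ ::=* _]\<close> [300, 0, 0] 300) is "\<lambda>t \<alpha> v. pmsubst \<alpha> v t"
  by (rule scoped_pmsubst)

definition closed_trm :: "('x, 'm) trm \<Rightarrow> bool" where
  "closed_trm t \<longleftrightarrow> fv t = {} \<and> fmv t = {}"

text \<open>Renaming of free names, used only to express alpha-equivalence below.\<close>

lift_definition rename :: "('x \<Rightarrow> 'x) \<Rightarrow> ('m \<Rightarrow> 'm) \<Rightarrow> ('x, 'm) trm \<Rightarrow> ('x, 'm) trm" is pmap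
  by (simp add: scoped_pmap)


subsection \<open>Adequacy of the representation\<close>

lemma bind_ref_inj:
  "below k r \<Longrightarrow> below k s \<Longrightarrow> bind_ref k x r = bind_ref k x s \<longleftrightarrow> r = s"
  by (cases r; cases s) (auto simp: bind_ref_def)

lemma pbind_inj:
  "scoped k l t \<Longrightarrow> scoped k l u \<Longrightarrow> pbind k x t = pbind k x u \<longleftrightarrow> t = u"
proof (induction t arbitrary: k l u)
  case (PVar r) then show ?case by (cases u) (auto simp: bind_ref_inj)
next
  case (PLam t) then show ?case by (cases u) auto
next
  case (PApp t1 t2)
  from PApp.prems show ?case
    by (cases u) (auto simp: PApp.IH)
next
  case (PMu t) then show ?case by (cases u) auto
next
  case (PNamed r t) then show ?case by (cases u) auto
qed

lemma pmbind_inj: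
  "scoped k l t \<Longrightarrow> scoped k l u \<Longrightarrow> pmbind l \<alpha> t = pmbind l \<alpha> u \<longleftrightarrow> t = u"
proof (induction t arbitrary: k l u)
  case (PVar r) then show ?case by (cases u) auto
next
  case (PLam t) then show ?case by (cases u) auto
next
  case (PApp t1 t2)
  from PApp.prems show ?case
    by (cases u) (auto simp: PApp.IH)
next
  case (PMu t) then show ?case by (cases u) auto
next
  case (PNamed r t)
  from PNamed.prems show ?case
    by (cases u) (auto simp: bind_ref_inj PNamed.IH)
qed

lemma Lam_inject: "Lam x t = Lam x u \<longleftrightarrow> t = u"
  by transfer (auto simp: pbind_inj)

lemma Mu_inject: "Mu \<alpha> t = Mu \<alpha> u \<longleftrightarrow> t = u"
  by transfer (auto simp: pmbind_inj)

lemma Var_inject: "Var x = Var y \<longleftrightarrow> x = y"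
  by transfer simp

lemma App_inject: "App t u = App t' u' \<longleftrightarrow> t = t' \<and> u = u'"
  by transfer simp

lemma Named_inject: "Named \<alpha> t = Named \<beta> u \<longleftrightarrow> \<alpha> = \<beta> \<and> t = u"
  by transfer simp

lemma bind_ref_rename:
  "y \<notin> names r \<Longrightarrow> bind_ref k y (map_ref (id(x := y)) r) = bind_ref k x r"
  by (cases r) (auto simp: bind_ref_def)

lemma pbind_rename:
  "y \<notin> pfv t \<Longrightarrow> pbind k y (pmap (id(x := y)) id t) = pbind k x t"
  by (induction t arbitrary: k) (auto simp: bind_ref_rename ref.map_id)

lemma pmbind_rename:
  "\<beta> \<notin> pfmv t \<Longrightarrow> pmbind l \<beta> (pmap id (id(\<alpha> := \<beta>)) t) = pmbind l \<alpha> t"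
  by (induction t arbitrary: l) (auto simp: bind_ref_rename ref.map_id)

lemma Lam_alpha: "y \<notin> fv t \<Longrightarrow> Lam x t = Lam y (rename (id(x := y)) id t)"
  by transfer (simp add: pbind_rename)

lemma Mu_alpha: "\<beta> \<notin> fmv t \<Longrightarrow> Mu \<alpha> t = Mu \<beta> (rename id (id(\<alpha> := \<beta>)) t)"
  by transfer (simp add: pmbind_rename)

lemma names_bind_ref: "names (bind_ref k x r) = names r - {x}"
  by (cases r) (auto simp: bind_ref_def)

lemma pfv_pbind: "pfv (pbind k x t) = pfv t - {x}"
  by (induction t arbitrary: k) (auto simp: names_bind_ref)

lemma pfmv_pbind: "pfmv (pbind k x t) = pfmv t"
  by (induction t arbitrary: k) auto

lemma pfmv_pmbind: "pfmv (pmbind l \<alpha> t) = pfmv t - {\<alpha>}"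
  by (induction t arbitrary: l) (auto simp: names_bind_ref)

lemma pfv_pmbind: "pfv (pmbind l \<alpha> t) = pfv t"
  by (induction t arbitrary: l) auto

lemma fv_simps:
  "fv (Var x) = {x}"
  "fv (Lam x t) = fv t - {x}"
  "fv (App t u) = fv t \<union> fv u"
  "fv (Mu \<alpha> t) = fv t"
  "fv (Named \<alpha> t) = fv t"
  by (transfer; simp add: pfv_pbind pfv_pmbind)+

lemma fmv_simps:
  "fmv (Var x) = {}"
  "fmv (Lam x t) = fmv t"
  "fmv (App t u) = fmv t \<union> fmv u"
  "fmv (Mu \<alpha> t) = fmv t - {\<alpha>}"
  "fmv (Named \<alpha> t) = insert \<alpha> (fmv t)"
  by (transfer; simp add: pfmv_pbind pfmv_pmbind)+

lemma finite_names: "finite (names r)"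
  by (cases r) auto

lemma finite_fv: "finite (fv t)"
proof transfer
  show "finite (pfv t)" for t :: "('x, 'm) ptrm"
    by (induction t) (auto simp: finite_names)
qed

lemma finite_fmv: "finite (fmv t)"
proof transfer
  show "finite (pfmv t)" for t :: "('x, 'm) ptrm"
    by (induction t) (auto simp: finite_names)
qed

lemma pbind_fresh: "x \<notin> pfv t \<Longrightarrow> pbind k x t = t"
  by (induction t arbitrary: k) (auto simp: bind_ref_def)

lemma pmbind_fresh: "\<alpha> \<notin> pfmv t \<Longrightarrow> pmbind l \<alpha> t = t"
  by (induction t arbitrary: l) (auto simp: bind_ref_def)

lemma psubst_pbind:
  "y \<noteq> x \<Longrightarrow> y \<notin> pfv v \<Longrightarrow> psubst x v (pbind k y t) = pbind k y (psubst x v t)"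
  by (induction t arbitrary: k) (auto simp: bind_ref_def pbind_fresh)

lemma psubst_pmbind:
  "\<alpha> \<notin> pfmv v \<Longrightarrow> psubst x v (pmbind l \<alpha> t) = pmbind l \<alpha> (psubst x v t)"
  by (induction t arbitrary: l) (auto simp: bind_ref_def pmbind_fresh)

lemma pmsubst_pbind:
  "y \<notin> pfv v \<Longrightarrow> pmsubst \<alpha> v (pbind k y t) = pbind k y (pmsubst \<alpha> v t)"
  by (induction t arbitrary: k) (auto simp: bind_ref_def pbind_fresh)

lemma pmsubst_pmbind:
  "\<beta> \<noteq> \<alpha> \<Longrightarrow> \<beta> \<notin> pfmv v \<Longrightarrow> pmsubst \<alpha> v (pmbind l \<beta> t) = pmbind l \<beta> (pmsubst \<alpha> v t)"
  by (induction t arbitrary: l) (auto simp: bind_ref_def pmbind_fresh)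

lemma subst_simps:
  "(Var y)[x ::= v] = (if y = x then v else Var y)"
  "y \<noteq> x \<Longrightarrow> y \<notin> fv v \<Longrightarrow> (Lam y t)[x ::= v] = Lam y (t[x ::= v])"
  "(App t u)[x ::= v] = App (t[x ::= v]) (u[x ::= v])"
  "\<alpha> \<notin> fmv v \<Longrightarrow> (Mu \<alpha> t)[x ::= v] = Mu \<alpha> (t[x ::= v])"
  "(Named \<alpha> t)[x ::= v] = Named \<alpha> (t[x ::= v])"
  by (transfer; simp add: psubst_pbind psubst_pmbind)+

lemma msubst_simps:
  "(Var y)[\<alpha> ::=* v] = Var y"
  "y \<notin> fv v \<Longrightarrow> (Lam y t)[\<alpha> ::=* v] = Lam y (t[\<alpha> ::=* v])"
  "(App t u)[\<alpha> ::=* v] = App (t[\<alpha> ::=* v]) (u[\<alpha> ::=* v])"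
  "\<beta> \<noteq> \<alpha> \<Longrightarrow> \<beta> \<notin> fmv v \<Longrightarrow> (Mu \<beta> t)[\<alpha> ::=* v] = Mu \<beta> (t[\<alpha> ::=* v])"
  "(Named \<beta> t)[\<alpha> ::=* v] =
     (if \<beta> = \<alpha> then Named \<alpha> (App (t[\<alpha> ::=* v]) v) else Named \<beta> (t[\<alpha> ::=* v]))"
  by (transfer; simp add: pmsubst_pbind pmsubst_pmbind)+

text \<open>Every term is built by the named constructors, and the bound name can be chosen outside any
  given finite set. The recursion behind the induction principle is on the size of the preterm,
  opened by substituting a fresh name for the outermost index.\<close>

primrec popen :: "nat \<Rightarrow> 'x \<Rightarrow> ('x, 'm) ptrm \<Rightarrow> ('x, 'm) ptrm" where
  "popen k x (PVar r) = PVar (if r = Bound k then Free x else r)"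
| "popen k x (PLam t) = PLam (popen (Suc k) x t)"
| "popen k x (PApp t u) = PApp (popen k x t) (popen k x u)"
| "popen k x (PMu t) = PMu (popen k x t)"
| "popen k x (PNamed r t) = PNamed r (popen k x t)"

primrec pmopen :: "nat \<Rightarrow> 'm \<Rightarrow> ('x, 'm) ptrm \<Rightarrow> ('x, 'm) ptrm" where
  "pmopen l \<alpha> (PVar r) = PVar r"
| "pmopen l \<alpha> (PLam t) = PLam (pmopen l \<alpha> t)"
| "pmopen l \<alpha> (PApp t u) = PApp (pmopen l \<alpha> t) (pmopen l \<alpha> u)"
| "pmopen l \<alpha> (PMu t) = PMu (pmopen (Suc l) \<alpha> t)"
| "pmopen l \<alpha> (PNamed r t) = PNamed (if r = Bound l then Free \<alpha> else r) (pmopen l \<alpha> t)"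

lemma pbind_popen: "x \<notin> pfv t \<Longrightarrow> pbind k x (popen k x t) = t"
  by (induction t arbitrary: k) (auto simp: bind_ref_def)

lemma pmbind_pmopen: "\<alpha> \<notin> pfmv t \<Longrightarrow> pmbind l \<alpha> (pmopen l \<alpha> t) = t"
  by (induction t arbitrary: l) (auto simp: bind_ref_def)

lemma below_open: "below (Suc k) r \<Longrightarrow> below k (if r = Bound k then Free x else r)"
  by (cases r) auto

lemma scoped_popen: "scoped (Suc k) l t \<Longrightarrow> scoped k l (popen k x t)"
  by (induction t arbitrary: k l) (auto dest: below_open split: if_splits)

lemma scoped_pmopen: "scoped k (Suc l) t \<Longrightarrow> scoped k l (pmopen l \<alpha> t)"
  by (induction t arbitrary: k l) (auto dest: below_open split: if_splits)

primrec psize :: "('x, 'm) ptrm \<Rightarrow> nat" where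
  "psize (PVar r) = 0"
| "psize (PLam t) = Suc (psize t)"
| "psize (PApp t u) = Suc (psize t + psize u)"
| "psize (PMu t) = Suc (psize t)"
| "psize (PNamed r t) = Suc (psize t)"

lemma psize_popen: "psize (popen k x t) = psize t"
  by (induction t arbitrary: k) auto

lemma psize_pmopen: "psize (pmopen l \<alpha> t) = psize t"
  by (induction t arbitrary: l) auto

lemma trm_induct [case_names Var Lam App Mu Named]:
  fixes t :: "('x :: infinite, 'm :: infinite) trm"
  assumes "finite F" "finite G"
    and var: "\<And>x. P (Var x)"
    and lam: "\<And>x t. x \<notin> F \<Longrightarrow> P t \<Longrightarrow> P (Lam x t)"
    and app: "\<And>t u. P t \<Longrightarrow> P u \<Longrightarrow> P (App t u)"
    and mu: "\<And>\<alpha> t. \<alpha> \<notin> G \<Longrightarrow> P t \<Longrightarrow> P (Mu \<alpha> t)"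
    and named: "\<And>\<alpha> t. P t \<Longrightarrow> P (Named \<alpha> t)"
  shows "P t"
proof -
  have "scoped 0 0 p \<Longrightarrow> P (Abs_trm p)" for p
  proof (induction "psize p" arbitrary: p rule: less_induct)
    case less
    show ?case
    proof (cases p)
      case (PVar r)
      with less.prems obtain x where "p = PVar (Free x)" by (cases r) auto
      then show ?thesis using var[of x] by (simp add: Var_def)
    next
      case (PLam q)
      have "finite (F \<union> pfv q)" using assms(1) finite_fv
        by (induction q) (auto simp: finite_names)
      then obtain x where x: "x \<notin> F" "x \<notin> pfv q"
        using ex_new_if_finite[OF infinite_UNIV] by blast
      have sc: "scoped 0 0 (popen 0 x q)" using less.prems PLam by (simp add: scoped_popen)
      have "P (Abs_trm (popen 0 x q))"
        using less.hyps[of "popen 0 x q"] sc PLam by (simp add: psize_popen)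
      then have "P (Lam x (Abs_trm (popen 0 x q)))" using lam x by blast
      moreover have "Lam x (Abs_trm (popen 0 x q)) = Abs_trm p"
        using sc x PLam by (simp add: Lam_def Abs_trm_inverse pbind_popen)
      ultimately show ?thesis by simp
    next
      case (PApp q r)
      then have "P (App (Abs_trm q) (Abs_trm r))"
        using less.prems by (intro app less.hyps) auto
      then show ?thesis using less.prems PApp by (simp add: App_def Abs_trm_inverse)
    next
      case (PMu q)
      have "finite (G \<union> pfmv q)" using assms(2)
        by (induction q) (auto simp: finite_names)
      then obtain \<alpha> where \<alpha>: "\<alpha> \<notin> G" "\<alpha> \<notin> pfmv q"
        using ex_new_if_finite[OF infinite_UNIV] by blast
      have sc: "scoped 0 0 (pmopen 0 \<alpha> q)" using less.prems PMu by (simp add: scoped_pmopen)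
      have "P (Abs_trm (pmopen 0 \<alpha> q))"
        using less.hyps[of "pmopen 0 \<alpha> q"] sc PMu by (simp add: psize_pmopen)
      then have "P (Mu \<alpha> (Abs_trm (pmopen 0 \<alpha> q)))" using mu \<alpha> by blast
      moreover have "Mu \<alpha> (Abs_trm (pmopen 0 \<alpha> q)) = Abs_trm p"
        using sc \<alpha> PMu by (simp add: Mu_def Abs_trm_inverse pmbind_pmopen)
      ultimately show ?thesis by simp
    next
      case (PNamed r q)
      with less.prems obtain \<alpha> where p: "p = PNamed (Free \<alpha>) q" by (cases r) auto
      then have "P (Named \<alpha> (Abs_trm q))"
        using less.prems by (intro named less.hyps) auto
      then show ?thesis using less.prems p by (simp add: Named_def Abs_trm_inverse)
    qed
  qed
  from this[of "Rep_trm t"] show ?thesis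
    using Rep_trm[of t] by (simp add: Rep_trm_inverse)
qed


section \<open>Reduction\<close>

text \<open>The side condition of the rule \<open>mu\<close> is the usual variable convention: it prevents the free
  occurrences of \<open>\<alpha>\<close> in \<open>v\<close> from being captured, and can always be met by renaming \<open>\<alpha>\<close>.\<close>

inductive red :: "('x, 'm) trm \<Rightarrow> ('x, 'm) trm \<Rightarrow> bool" (infix \<open>\<triangleright>\<close> 50) where
  beta: "App (Lam x u) v \<triangleright> u[x ::= v]"
| mu: "\<alpha> \<notin> fmv v \<Longrightarrow> App (Mu \<alpha> u) v \<triangleright> Mu \<alpha> (u[\<alpha> ::=* v])"
| lam_cong: "t \<triangleright> t' \<Longrightarrow> Lam x t \<triangleright> Lam x t'"
| app_cong1: "t \<triangleright> t' \<Longrightarrow> App t u \<triangleright> App t' u"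
| app_cong2: "u \<triangleright> u' \<Longrightarrow> App t u \<triangleright> App t u'"
| mu_cong: "t \<triangleright> t' \<Longrightarrow> Mu \<alpha> t \<triangleright> Mu \<alpha> t'"
| named_cong: "t \<triangleright> t' \<Longrightarrow> Named \<alpha> t \<triangleright> Named \<alpha> t'"

abbreviation reds :: "('x, 'm) trm \<Rightarrow> ('x, 'm) trm \<Rightarrow> bool" (infix \<open>\<triangleright>\<^sup>*\<close> 50) where
  "reds \<equiv> red\<^sup>*\<^sup>*"

definition Apps :: "('x, 'm) trm \<Rightarrow> ('x, 'm) trm list \<Rightarrow> ('x, 'm) trm" where
  "Apps t us = foldl App t us"


section \<open>Types\<close>

datatype 'p ty = TVar 'p | Bot | Fun "'p ty" "'p ty" (infixr \<open>\<rightarrow>\<close> 60)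

text \<open>A context, being a set of declarations of distinct variables, is a partial map from variables
  to types.\<close>

inductive typing ::
    "('x \<rightharpoonup> 'p ty) \<Rightarrow> ('x, 'm) trm \<Rightarrow> 'p ty \<Rightarrow> ('m \<rightharpoonup> 'p ty) \<Rightarrow> bool"
    (\<open>_ \<turnstile> _ : _ ; _\<close> [50, 50, 50, 50] 50) where
  ax: "\<Gamma> x = Some A \<Longrightarrow> \<Gamma> \<turnstile> Var x : A ; \<Delta>"
| fun_i: "x \<notin> dom \<Gamma> \<Longrightarrow> \<Gamma>(x \<mapsto> A) \<turnstile> t : B ; \<Delta> \<Longrightarrow> \<Gamma> \<turnstile> Lam x t : A \<rightarrow> B ; \<Delta>"
| fun_e: "\<Gamma> \<turnstile> u : A \<rightarrow> B ; \<Delta> \<Longrightarrow> \<Gamma> \<turnstile> v : A ; \<Delta> \<Longrightarrow> \<Gamma> \<turnstile> App u v : B ; \<Delta>"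
| mu: "\<alpha> \<notin> dom \<Delta> \<Longrightarrow> \<Gamma> \<turnstile> t : Bot ; \<Delta>(\<alpha> \<mapsto> A) \<Longrightarrow> \<Gamma> \<turnstile> Mu \<alpha> t : A ; \<Delta>"
| bot: "\<Delta> \<alpha> = Some A \<Longrightarrow> \<Gamma> \<turnstile> t : A ; \<Delta> \<Longrightarrow> \<Gamma> \<turnstile> Named \<alpha> t : Bot ; \<Delta>"


section \<open>Semantics\<close>

definition saturated :: "('x, 'm) trm set \<Rightarrow> bool" where
  "saturated S \<longleftrightarrow> (\<forall>u v. v \<triangleright>\<^sup>* u \<longrightarrow> u \<in> S \<longrightarrow> v \<in> S)"

definition arrow :: "('x, 'm) trm set \<Rightarrow> ('x, 'm) trm set \<Rightarrow> ('x, 'm) trm set"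
    (infixr \<open>\<leadsto>\<close> 60) where
  "K \<leadsto> L = {t. \<forall>u\<in>K. App t u \<in> L}"

definition seq_arrow :: "('x, 'm) trm list set \<Rightarrow> ('x, 'm) trm set \<Rightarrow> ('x, 'm) trm set"
    (infixr \<open>\<leadsto>\<^sub>s\<close> 60) where
  "X \<leadsto>\<^sub>s L = {t. \<forall>us\<in>X. Apps t us \<in> L}"

text \<open>The values of the families outside the index sets are irrelevant.\<close>

record ('x, 'm) model =
  I_idx :: "nat set"
  J_idx :: "nat set"
  C_fam :: "nat \<Rightarrow> 'm set"
  B_fam :: "nat \<Rightarrow> ('x, 'm) trm set"
  R_fam :: "nat \<Rightarrow> ('x, 'm) trm set"

definition is_model :: "('x, 'm) model \<Rightarrow> bool" where
  "is_model M \<longleftrightarrow>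
     0 \<in> I_idx M \<and>
     (\<forall>i\<in>I_idx M. infinite (C_fam M i)) \<and>
     disjoint_family_on (C_fam M) (I_idx M) \<and>
     (\<forall>i\<in>I_idx M. B_fam M i \<noteq> {} \<and> saturated (B_fam M i)) \<and>
     (\<forall>j\<in>J_idx M. R_fam M j \<noteq> {} \<and> saturated (R_fam M j)) \<and>
     (\<forall>i\<in>I_idx M. \<forall>\<alpha>\<in>C_fam M i. \<forall>u\<in>B_fam M 0. Mu \<alpha> u \<in> B_fam M i) \<and>
     (\<forall>i\<in>I_idx M. \<forall>\<alpha>\<in>C_fam M i. \<forall>u\<in>B_fam M i. Named \<alpha> u \<in> B_fam M 0) \<and>
     (\<forall>j\<in>J_idx M. \<exists>i\<in>I_idx M. \<exists>X. R_fam M j = (X \<leadsto>\<^sub>s B_fam M i))"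

inductive_set universe :: "('x, 'm) model \<Rightarrow> ('x, 'm) trm set set" for M where
  B: "i \<in> I_idx M \<Longrightarrow> B_fam M i \<in> universe M"
| R: "j \<in> J_idx M \<Longrightarrow> R_fam M j \<in> universe M"
| arrow: "K \<in> universe M \<Longrightarrow> L \<in> universe M \<Longrightarrow> (K \<leadsto> L) \<in> universe M"

definition is_interp :: "('x, 'm) model \<Rightarrow> ('p \<Rightarrow> ('x, 'm) trm set) \<Rightarrow> bool" where
  "is_interp M \<I> \<longleftrightarrow> (\<forall>X. \<I> X \<in> universe M)"

primrec interp ::
    "('x, 'm) model \<Rightarrow> ('p \<Rightarrow> ('x, 'm) trm set) \<Rightarrow> 'p ty \<Rightarrow> ('x, 'm) trm set" where
  "interp M \<I> (TVar X) = \<I> X"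
| "interp M \<I> Bot = B_fam M 0"
| "interp M \<I> (A \<rightarrow> B) = (interp M \<I> A \<leadsto> interp M \<I> B)"

definition sem_in :: "('x, 'm) model \<Rightarrow> 'p ty \<Rightarrow> ('x, 'm) trm set" where
  "sem_in M A = \<Inter>{interp M \<I> A | \<I>. is_interp M \<I>}"

definition sem :: "'p ty \<Rightarrow> ('x, 'm) trm set" where
  "sem A = \<Inter>{sem_in M A | M. is_model M}"

end

theory Submission
  imports Defs "HOL-Library.Nat_Bijection"
begin

text \<open>
  Soundness is realizability: every set of the universe is saturated and of the form
  \<open>X \<leadsto> B\<^sub>i\<close>, so a declaration \<open>\<alpha> : A\<close> is realized by replacing \<open>(\<alpha> w)\<close> by \<open>(\<beta> (w v\<^sub>1 \<dots> v\<^sub>n))\<close> with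
  \<open>\<beta> \<in> C\<^sub>i\<close> and \<open>v\<^sub>1 \<dots> v\<^sub>n \<in> X\<close>, where \<open>A\<close> is interpreted by \<open>X \<leadsto> B\<^sub>i\<close>.

  For completeness take a term model: \<open>B\<^sub>i\<close> is the set of terms that reduce to a term of type \<open>A\<^sub>i\<close> in
  fixed infinite contexts, the \<open>A\<^sub>i\<close> being \<open>\<bottom>\<close> and the subformulas of \<open>A\<close>. Every \<open>A\<^sub>i\<close> is then
  interpreted by \<open>B\<^sub>i\<close>; the point is that \<open>t\<close> reduces to a term of type \<open>B \<rightarrow> C\<close> as soon as \<open>(t x)\<close>,
  with \<open>x : B\<close>, reduces to a term of type \<open>C\<close>.

  Binders are handled on preterms by parallel substitution: every reference is either \<open>Bound 0\<close> or a
  shift, so free names and dangling indices obey the same laws.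
\<close>

section \<open>Parallel renaming and substitution\<close>

text \<open>Soundness is shaped by the fact that a \<open>\<mu>\<close>-abstraction absorbs its
  arguments one at a time and remains an abstraction. The closure of \<open>B_fam M i\<close> under
  \<open>\<mu>\<close> therefore applies only once a whole sequence from \<open>X\<close> has been
  absorbed, and the name from \<open>C_fam M i\<close> is chosen only then. In the term model the
  declarations are dictated by the conditions on a model. Giving every name in
  \<open>C_fam M i\<close> the type of index \<open>i\<close> yields the two closure conditions, and
  a variable of that type makes \<open>B_fam M i\<close> inhabited. The same variable serves as the
  test argument, and this is the main obstacle: it has to test all terms of an arrow, including
  those in which it already occurs. In a reduct of \<open>(t x)\<close> the inserted occurrences of
  \<open>x\<close> look like the old ones, so a relation between \<open>t\<close> and the reduct has
  to remember which of them were inserted.\<close>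

fun shift :: "'v ref \<Rightarrow> 'v ref" where
  "shift (Free x) = Free x"
| "shift (Bound i) = Bound (Suc i)"

fun scons :: "'a \<Rightarrow> ('v ref \<Rightarrow> 'a) \<Rightarrow> 'v ref \<Rightarrow> 'a" where
  "scons a h (Free x) = h (Free x)"
| "scons a h (Bound 0) = a"
| "scons a h (Bound (Suc i)) = h (Bound i)"

lemma ref_cases [case_names zero shift]:
  obtains "r = Bound 0" | s where "r = shift s"
proof (cases r)
  case (Free x)
  then show ?thesis using that(2)[of "Free x"] by simp
next
  case (Bound i)
  then show ?thesis using that(1) that(2)[of "Bound (i - 1)"] by (cases i) auto
qed

lemma scons_shift [simp]: "scons a h (shift r) = h r"
  by (cases r) auto

lemma shift_eq_Free [simp]: "shift r = Free x \<longleftrightarrow> r = Free x"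
  by (cases r) auto

lemma below_shift [simp]: "below (Suc k) (shift r) \<longleftrightarrow> below k r"
  by (cases r) auto

text \<open>Functions on references are compared at index 0 and at shifts, the two cases of
  \<open>ref_cases\<close>. Free names fall under the second case because \<open>shift\<close> fixes
  them.\<close>

lemma scons_eqI: "a = h (Bound 0) \<Longrightarrow> (\<And>r. g r = h (shift r)) \<Longrightarrow> scons a g = h"
  by (rule ext) (metis ref_cases scons.simps(2) scons_shift)

definition lift_ren :: "('v ref \<Rightarrow> 'w ref) \<Rightarrow> 'v ref \<Rightarrow> 'w ref" where
  "lift_ren \<xi> = scons (Bound 0) (shift \<circ> \<xi>)"

lemma lift_ren_simps [simp]:
  "lift_ren \<xi> (Bound 0) = Bound 0"
  "lift_ren \<xi> (shift r) = shift (\<xi> r)"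
  by (auto simp: lift_ren_def)

lemma lift_ren_id [simp]: "lift_ren id = id"
  unfolding lift_ren_def by (rule scons_eqI) auto

lemma lift_ren_comp: "lift_ren \<xi> \<circ> lift_ren \<xi>' = lift_ren (\<xi> \<circ> \<xi>')"
  unfolding lift_ren_def[of "\<xi> \<circ> \<xi>'"] by (rule scons_eqI[symmetric]) auto

fun pren :: "('x ref \<Rightarrow> 'y ref) \<Rightarrow> ('m ref \<Rightarrow> 'n ref) \<Rightarrow> ('x, 'm) ptrm \<Rightarrow> ('y, 'n) ptrm" where
  "pren \<xi> \<zeta> (PVar r) = PVar (\<xi> r)"
| "pren \<xi> \<zeta> (PLam t) = PLam (pren (lift_ren \<xi>) \<zeta> t)"
| "pren \<xi> \<zeta> (PApp t u) = PApp (pren \<xi> \<zeta> t) (pren \<xi> \<zeta> u)"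
| "pren \<xi> \<zeta> (PMu t) = PMu (pren \<xi> (lift_ren \<zeta>) t)"
| "pren \<xi> \<zeta> (PNamed r t) = PNamed (\<zeta> r) (pren \<xi> \<zeta> t)"

abbreviation shift_lam :: "('x, 'm) ptrm \<Rightarrow> ('x, 'm) ptrm" where
  "shift_lam \<equiv> pren shift id"

abbreviation shift_mu :: "('x, 'm) ptrm \<Rightarrow> ('x, 'm) ptrm" where
  "shift_mu \<equiv> pren id shift"

definition PApps :: "('x, 'm) ptrm \<Rightarrow> ('x, 'm) ptrm list \<Rightarrow> ('x, 'm) ptrm" where
  "PApps t us = foldl PApp t us"

lemma PApps_simps [simp]:
  "PApps t [] = t"
  "PApps t (us @ vs) = PApps (PApps t us) vs"
  by (simp_all add: PApps_def)

lemma PApps_Cons: "PApps t (u # us) = PApps (PApp t u) us"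
  by (simp add: PApps_def)

section \<open>Parallel substitution and its composition laws\<close>

definition lift_sub :: "('v ref \<Rightarrow> ('x, 'm) ptrm) \<Rightarrow> 'v ref \<Rightarrow> ('x, 'm) ptrm" where
  "lift_sub f = scons (PVar (Bound 0)) (shift_lam \<circ> f)"

definition lift_msub ::
    "('v ref \<Rightarrow> 'm ref \<times> ('x, 'm) ptrm list) \<Rightarrow> 'v ref \<Rightarrow> 'm ref \<times> ('x, 'm) ptrm list" where
  "lift_msub g = scons (Bound 0, []) (map_prod shift (map shift_mu) \<circ> g)"

lemma lift_sub_simps [simp]:
  "lift_sub f (Bound 0) = PVar (Bound 0)"
  "lift_sub f (shift r) = shift_lam (f r)"
  by (auto simp: lift_sub_def)

lemma lift_msub_simps [simp]:
  "lift_msub g (Bound 0) = (Bound 0, [])"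
  "lift_msub g (shift r) = map_prod shift (map shift_mu) (g r)"
  by (auto simp: lift_msub_def)

text \<open>Substitutes the terms \<open>f r\<close> for the \<open>\<lambda>\<close>-variables and, where \<open>g \<alpha> = (\<beta>, v\<^sub>1 \<dots> v\<^sub>n)\<close>, replaces
  each subterm \<open>(\<alpha> w)\<close> by \<open>(\<beta> (w v\<^sub>1 \<dots> v\<^sub>n))\<close>. Renaming and both substitutions of the calculus are
  instances.\<close>

fun psub :: "('x ref \<Rightarrow> ('y, 'n) ptrm) \<Rightarrow> ('m ref \<Rightarrow> 'n ref \<times> ('y, 'n) ptrm list) \<Rightarrow>
    ('x, 'm) ptrm \<Rightarrow> ('y, 'n) ptrm" where
  "psub f g (PVar r) = f r"
| "psub f g (PLam t) = PLam (psub (lift_sub f) (map_prod id (map shift_lam) \<circ> g) t)"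
| "psub f g (PApp t u) = PApp (psub f g t) (psub f g u)"
| "psub f g (PMu t) = PMu (psub (shift_mu \<circ> f) (lift_msub g) t)"
| "psub f g (PNamed r t) = PNamed (fst (g r)) (PApps (psub f g t) (snd (g r)))"

lemma pren_id [simp]: "pren id id t = t"
  by (induction t) (simp_all del: id_apply, simp_all)

lemma pren_PApps [simp]: "pren \<xi> \<zeta> (PApps t us) = PApps (pren \<xi> \<zeta> t) (map (pren \<xi> \<zeta>) us)"
  by (induction us rule: rev_induct) (auto simp: PApps_def)

lemma psub_PApps [simp]: "psub f g (PApps t us) = PApps (psub f g t) (map (psub f g) us)"
  by (induction us rule: rev_induct) (auto simp: PApps_def)

lemma pren_pren: "pren \<xi> \<zeta> (pren \<xi>' \<zeta>' t) = pren (\<xi> \<circ> \<xi>') (\<zeta> \<circ> \<zeta>') t"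
  by (induction t arbitrary: \<xi> \<zeta> \<xi>' \<zeta>') (auto simp: lift_ren_comp)

lemma lift_ren_comp_shift: "lift_ren \<xi> \<circ> shift = shift \<circ> \<xi>"
  by auto

lemma pren_shift_lam: "pren (lift_ren \<xi>) \<zeta> (shift_lam t) = shift_lam (pren \<xi> \<zeta> t)"
  by (simp add: pren_pren lift_ren_comp_shift)

lemma pren_shift_mu: "pren \<xi> (lift_ren \<zeta>) (shift_mu t) = shift_mu (pren \<xi> \<zeta> t)"
  by (simp add: pren_pren lift_ren_comp_shift)

lemma lift_sub_comp_ren: "lift_sub f \<circ> lift_ren \<xi> = lift_sub (f \<circ> \<xi>)"
  unfolding lift_sub_def[of "f \<circ> \<xi>"] by (rule scons_eqI[symmetric]) auto

lemma lift_msub_comp_ren: "lift_msub g \<circ> lift_ren \<zeta> = lift_msub (g \<circ> \<zeta>)"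
  unfolding lift_msub_def[of "g \<circ> \<zeta>"] by (rule scons_eqI[symmetric]) auto

lemma psub_pren: "psub f g (pren \<xi> \<zeta> t) = psub (f \<circ> \<xi>) (g \<circ> \<zeta>) t"
  by (induction t arbitrary: f g \<xi> \<zeta>)
    (auto simp: lift_sub_comp_ren lift_msub_comp_ren comp_assoc)

lemma pren_lift_sub: "pren (lift_ren \<xi>) \<zeta> \<circ> lift_sub f = lift_sub (pren \<xi> \<zeta> \<circ> f)"
  unfolding lift_sub_def[of "pren \<xi> \<zeta> \<circ> f"]
  by (rule scons_eqI[symmetric]) (auto simp: pren_shift_lam)

lemma map_prod_pren_lift_msub:
  "map_prod (lift_ren \<zeta>) (map (pren \<xi> (lift_ren \<zeta>))) \<circ> lift_msub g =
   lift_msub (map_prod \<zeta> (map (pren \<xi> \<zeta>)) \<circ> g)"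
  unfolding lift_msub_def[of "map_prod \<zeta> (map (pren \<xi> \<zeta>)) \<circ> g"]
  by (rule scons_eqI[symmetric])
    (auto simp: pren_shift_mu map_prod_def split: prod.split)

lemma pren_psub:
  "pren \<xi> \<zeta> (psub f g t) = psub (pren \<xi> \<zeta> \<circ> f) (map_prod \<zeta> (map (pren \<xi> \<zeta>)) \<circ> g) t"
proof (induction t arbitrary: \<xi> \<zeta> f g)
  case (PLam t)
  have "map_prod \<zeta> (map (pren (lift_ren \<xi>) \<zeta>)) \<circ> (map_prod id (map shift_lam) \<circ> g) =
        map_prod id (map shift_lam) \<circ> (map_prod \<zeta> (map (pren \<xi> \<zeta>)) \<circ> g)"
    by (auto simp: fun_eq_iff map_prod_def pren_shift_lam split: prod.split)
  then show ?case by (simp add: PLam pren_lift_sub del: comp_apply)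
next
  case (PMu t)
  have "pren \<xi> (lift_ren \<zeta>) \<circ> (shift_mu \<circ> f) = shift_mu \<circ> (pren \<xi> \<zeta> \<circ> f)"
    by (auto simp: pren_shift_mu)
  then show ?case by (simp add: PMu map_prod_pren_lift_msub del: comp_apply)
qed auto

text \<open>The arguments added by the inner substitution stand next to the named subterm, so they
  come first and are themselves hit by the outer substitution.\<close>

definition comp_msub ::
    "('x ref \<Rightarrow> ('y, 'n) ptrm) \<Rightarrow> ('m ref \<Rightarrow> 'n ref \<times> ('y, 'n) ptrm list) \<Rightarrow>
     ('k ref \<Rightarrow> 'm ref \<times> ('x, 'm) ptrm list) \<Rightarrow> 'k ref \<Rightarrow> 'n ref \<times> ('y, 'n) ptrm list" where
  "comp_msub f g g' r = (fst (g (fst (g' r))), map (psub f g) (snd (g' r)) @ snd (g (fst (g' r))))"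

lemma psub_shift_lam:
  "psub (lift_sub f) (map_prod id (map shift_lam) \<circ> g) (shift_lam t) = shift_lam (psub f g t)"
proof -
  have "lift_sub f \<circ> shift = shift_lam \<circ> f" by auto
  then show ?thesis by (simp add: psub_pren pren_psub)
qed

lemma psub_shift_mu:
  "psub (shift_mu \<circ> f) (lift_msub g) (shift_mu t) = shift_mu (psub f g t)"
proof -
  have "lift_msub g \<circ> shift = map_prod shift (map shift_mu) \<circ> g" by auto
  then show ?thesis by (simp add: psub_pren pren_psub)
qed

text \<open>Lifting is built from \<open>shift_lam\<close> and \<open>shift_mu\<close>, so composing
  under a binder rests on commuting substitution with these shifts. This in turn comes from the
  mixed laws \<open>psub_pren\<close> and \<open>pren_psub\<close>.\<close>

lemma psub_psub: "psub f g (psub f' g' t) = psub (psub f g \<circ> f') (comp_msub f g g') t"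
proof (induction t arbitrary: f g f' g')
  case (PLam t)
  have "psub (lift_sub f) (map_prod id (map shift_lam) \<circ> g) \<circ> lift_sub f' = lift_sub (psub f g \<circ> f')"
    unfolding lift_sub_def[of "psub f g \<circ> f'"]
    by (rule scons_eqI[symmetric]) (auto simp: psub_shift_lam)
  moreover have "comp_msub (lift_sub f) (map_prod id (map shift_lam) \<circ> g)
      (map_prod id (map shift_lam) \<circ> g') = map_prod id (map shift_lam) \<circ> comp_msub f g g'"
    by (auto simp: fun_eq_iff comp_msub_def psub_shift_lam)
  ultimately show ?case by (simp add: PLam del: comp_apply)
next
  case (PMu t)
  have "psub (shift_mu \<circ> f) (lift_msub g) \<circ> (shift_mu \<circ> f') = shift_mu \<circ> (psub f g \<circ> f')"
    by (auto simp: psub_shift_mu)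
  moreover have "comp_msub (shift_mu \<circ> f) (lift_msub g) (lift_msub g') = lift_msub (comp_msub f g g')"
    unfolding lift_msub_def[of "comp_msub f g g'"]
    by (rule scons_eqI[symmetric]) (auto simp: comp_msub_def psub_shift_mu)
  ultimately show ?case by (simp add: PMu del: comp_apply)
qed (auto simp: comp_msub_def)

abbreviation no_msub :: "'m ref \<Rightarrow> 'm ref \<times> ('x, 'm) ptrm list" where
  "no_msub r \<equiv> (r, [])"

lemma map_prod_no_args:
  "map_prod \<zeta>' (map h) \<circ> (\<lambda>r. (\<zeta> r, [])) = (\<lambda>r. (\<zeta>' (\<zeta> r), []))"
  by auto

lemma lift_sub_PVar: "lift_sub (\<lambda>r. PVar (\<xi> r)) = (\<lambda>r. PVar (lift_ren \<xi> r))"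
  unfolding lift_sub_def by (rule scons_eqI) auto

lemma lift_msub_no_args: "lift_msub (\<lambda>r. (\<zeta> r, [])) = (\<lambda>r. (lift_ren \<zeta> r, []))"
  unfolding lift_msub_def by (rule scons_eqI) auto

lemma lift_sub_id: "lift_sub PVar = PVar"
  using lift_sub_PVar[of id] by simp

lemma lift_msub_id: "lift_msub no_msub = no_msub"
  using lift_msub_no_args[of id] by simp

lemma pren_comp_PVar: "pren \<xi> \<zeta> \<circ> PVar = PVar \<circ> \<xi>"
  by auto

lemma shift_mu_PVar: "shift_mu \<circ> (\<lambda>r. PVar (\<xi> r)) = (\<lambda>r. PVar (\<xi> r))"
  by auto

lemma psub_ren: "psub (\<lambda>r. PVar (\<xi> r)) (\<lambda>r. (\<zeta> r, [])) t = pren \<xi> \<zeta> t"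
proof (induction t arbitrary: \<xi> \<zeta>)
  case (PLam t)
  then show ?case by (simp add: lift_sub_PVar map_prod_no_args del: comp_apply)
next
  case (PMu t)
  then show ?case by (simp add: lift_msub_no_args shift_mu_PVar del: comp_apply)
qed auto

lemma psub_id: "psub PVar no_msub t = t"
  using psub_ren[of id id t] by simp

section \<open>Scopes of renamed and substituted preterms\<close>

lemma scoped_pren:
  assumes "scoped k l t"
    and "\<And>r. below k r \<Longrightarrow> below k' (\<xi> r)" "\<And>r. below l r \<Longrightarrow> below l' (\<zeta> r)"
  shows "scoped k' l' (pren \<xi> \<zeta> t)"
  using assms
proof (induction t arbitrary: k l k' l' \<xi> \<zeta>)
  case (PLam t)
  have "below (Suc k) r \<Longrightarrow> below (Suc k') (lift_ren \<xi> r)" for r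
    using PLam.prems(2) by (cases r rule: ref_cases) auto
  then show ?case using PLam by auto
next
  case (PMu t)
  have "below (Suc l) r \<Longrightarrow> below (Suc l') (lift_ren \<zeta> r)" for r
    using PMu.prems(3) by (cases r rule: ref_cases) auto
  then show ?case using PMu by auto
qed auto

lemma scoped_PApps: "scoped k l (PApps t us) \<longleftrightarrow> scoped k l t \<and> (\<forall>u\<in>set us. scoped k l u)"
  by (induction us rule: rev_induct) (auto simp: PApps_def)

lemma scoped_psub:
  assumes "scoped k l t"
    and "\<And>r. below k r \<Longrightarrow> scoped k' l' (f r)" "\<And>r. below l r \<Longrightarrow> below l' (fst (g r))"
    and "\<And>r u. below l r \<Longrightarrow> u \<in> set (snd (g r)) \<Longrightarrow> scoped k' l' u"
  shows "scoped k' l' (psub f g t)"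
  using assms
proof (induction t arbitrary: k l k' l' f g)
  case (PLam t)
  have "scoped (Suc k') l' (psub (lift_sub f) (map_prod id (map shift_lam) \<circ> g) t)"
  proof (rule PLam.IH)
    show "scoped (Suc k) l t" using PLam.prems(1) by simp
    show "scoped (Suc k') l' (lift_sub f r)" if "below (Suc k) r" for r
      using that PLam.prems(2) by (cases r rule: ref_cases) (auto intro!: scoped_pren)
  qed (use PLam.prems(3,4) in \<open>auto intro!: scoped_pren\<close>)
  then show ?case by simp
next
  case (PMu t)
  have "scoped k' (Suc l') (psub (shift_mu \<circ> f) (lift_msub g) t)"
  proof (rule PMu.IH)
    show "scoped k (Suc l) t" using PMu.prems(1) by simp
    show "below (Suc l') (fst (lift_msub g r))" if "below (Suc l) r" for r
      using that PMu.prems(3) by (cases r rule: ref_cases) auto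
    show "scoped k' (Suc l') u" if "below (Suc l) r" "u \<in> set (snd (lift_msub g r))" for r u
      using that PMu.prems(4) by (cases r rule: ref_cases) (auto intro!: scoped_pren)
  qed (use PMu.prems(2) in \<open>auto intro!: scoped_pren\<close>)
  then show ?case by simp
qed (auto simp: scoped_PApps)

lemma psub_scoped_id:
  assumes "scoped k l t" "\<And>r. below k r \<Longrightarrow> f r = PVar r" "\<And>r. below l r \<Longrightarrow> g r = (r, [])"
  shows "psub f g t = t"
  using assms
proof (induction t arbitrary: k l f g)
  case (PLam t)
  have "psub (lift_sub f) (map_prod id (map shift_lam) \<circ> g) t = t"
  proof (rule PLam.IH)
    show "scoped (Suc k) l t" using PLam.prems(1) by simp
    show "lift_sub f r = PVar r" if "below (Suc k) r" for r
      using that PLam.prems(2) by (cases r rule: ref_cases) auto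
  qed (use PLam.prems(3) in auto)
  then show ?case by simp
next
  case (PMu t)
  have "psub (shift_mu \<circ> f) (lift_msub g) t = t"
  proof (rule PMu.IH)
    show "scoped k (Suc l) t" using PMu.prems(1) by simp
    show "lift_msub g r = (r, [])" if "below (Suc l) r" for r
      using that PMu.prems(3) by (cases r rule: ref_cases) auto
  qed (use PMu.prems(2) in auto)
  then show ?case by simp
qed auto

lemma pren_scoped_id:
  assumes "scoped k l t" "\<And>r. below k r \<Longrightarrow> \<xi> r = r" "\<And>r. below l r \<Longrightarrow> \<zeta> r = r"
  shows "pren \<xi> \<zeta> t = t"
  unfolding psub_ren[symmetric] using assms by (intro psub_scoped_id[of k l]) auto

section \<open>Reduction and typing of preterms\<close>

definition inst_lam :: "('x, 'm) ptrm \<Rightarrow> ('x, 'm) ptrm \<Rightarrow> ('x, 'm) ptrm" where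
  "inst_lam v u = psub (scons v PVar) no_msub u"

text \<open>The binder survives a \<open>\<mu>\<close>-step: index 0 stays in place and its subterms
  receive \<open>v\<close>, shifted below the binder. \<open>scons\<close> hands over the other
  references one level lower, hence the \<open>shift\<close> that restores them.\<close>

definition inst_mu :: "('x, 'm) ptrm \<Rightarrow> ('x, 'm) ptrm \<Rightarrow> ('x, 'm) ptrm" where
  "inst_mu v u = psub PVar (scons (Bound 0, [shift_mu v]) (\<lambda>r. (shift r, []))) u"

inductive pstep :: "('x, 'm) ptrm \<Rightarrow> ('x, 'm) ptrm \<Rightarrow> bool" where
  beta: "pstep (PApp (PLam u) v) (inst_lam v u)"
| mu: "pstep (PApp (PMu u) v) (PMu (inst_mu v u))"
| lam_cong: "pstep t t' \<Longrightarrow> pstep (PLam t) (PLam t')"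
| app_cong1: "pstep t t' \<Longrightarrow> pstep (PApp t u) (PApp t' u)"
| app_cong2: "pstep u u' \<Longrightarrow> pstep (PApp t u) (PApp t u')"
| mu_cong: "pstep t t' \<Longrightarrow> pstep (PMu t) (PMu t')"
| named_cong: "pstep t t' \<Longrightarrow> pstep (PNamed r t) (PNamed r t')"

lemma pren_inst_lam:
  "pren \<xi> \<zeta> (inst_lam v u) = inst_lam (pren \<xi> \<zeta> v) (pren (lift_ren \<xi>) \<zeta> u)"
proof -
  have "pren \<xi> \<zeta> \<circ> scons v PVar = scons (pren \<xi> \<zeta> v) PVar \<circ> lift_ren \<xi>"
    by (rule ext, rename_tac r, case_tac r rule: ref_cases) auto
  then show ?thesis
    by (simp add: inst_lam_def pren_psub psub_pren map_prod_no_args comp_def[of no_msub])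
qed

lemma pren_inst_mu:
  "pren \<xi> (lift_ren \<zeta>) (inst_mu v u) = inst_mu (pren \<xi> \<zeta> v) (pren \<xi> (lift_ren \<zeta>) u)"
proof -
  have "map_prod (lift_ren \<zeta>) (map (pren \<xi> (lift_ren \<zeta>))) \<circ>
      scons (Bound 0, [shift_mu v]) (\<lambda>r. (shift r, [])) =
    scons (Bound 0, [shift_mu (pren \<xi> \<zeta> v)]) (\<lambda>r. (shift r, [])) \<circ> lift_ren \<zeta>"
    by (rule ext, rename_tac r, case_tac r rule: ref_cases) (auto simp: pren_shift_mu)
  then show ?thesis
    by (simp add: inst_mu_def pren_psub psub_pren pren_comp_PVar)
qed

lemma finite_pfv: "finite (pfv t)" and finite_pfmv: "finite (pfmv t)"
  by (induction t) (auto simp: finite_names)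

lemma ex_fresh:
  fixes t u :: "('x :: infinite, 'm :: infinite) ptrm"
  shows "\<exists>x. x \<notin> pfv t \<and> x \<notin> pfv u" "\<exists>\<alpha>. \<alpha> \<notin> pfmv t \<and> \<alpha> \<notin> pfmv u"
  using ex_new_if_finite[OF infinite_UNIV, of "pfv t \<union> pfv u"]
    ex_new_if_finite[OF infinite_UNIV, of "pfmv t \<union> pfmv u"]
  by (auto simp: finite_pfv finite_pfmv)

section \<open>Named binding, opening and substitution as parallel operations\<close>

lemma pbind_eq_pren:
  assumes "scoped k l t" "\<And>r. below k r \<Longrightarrow> \<xi> r = bind_ref k x r"
  shows "pbind k x t = pren \<xi> id t"
  using assms
proof (induction t arbitrary: k l \<xi>)
  case (PLam t)
  have "lift_ren \<xi> r = bind_ref (Suc k) x r" if "below (Suc k) r" for r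
    using that PLam.prems(2) by (cases r rule: ref_cases) (auto simp: bind_ref_def)
  then show ?case using PLam.prems(1) by (auto simp del: id_apply intro!: PLam.IH)
next
  case (PMu t)
  from PMu.prems show ?case by (auto simp del: id_apply intro!: PMu.IH)
next
  case (PApp t u)
  then show ?case using PApp.IH(1)[of k l \<xi>] PApp.IH(2)[of k l \<xi>] by (simp del: id_apply)
qed auto

lemma pmbind_eq_pren:
  assumes "scoped k l t" "\<And>r. below l r \<Longrightarrow> \<zeta> r = bind_ref l \<alpha> r"
  shows "pmbind l \<alpha> t = pren id \<zeta> t"
  using assms
proof (induction t arbitrary: k l \<zeta>)
  case (PMu t)
  have "lift_ren \<zeta> r = bind_ref (Suc l) \<alpha> r" if "below (Suc l) r" for r
    using that PMu.prems(2) by (cases r rule: ref_cases) (auto simp: bind_ref_def)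
  then show ?case using PMu.prems(1) by (auto simp del: id_apply intro!: PMu.IH)
next
  case (PLam t)
  from PLam.prems show ?case by (auto simp del: id_apply intro!: PLam.IH)
next
  case (PApp t u)
  then show ?case using PApp.IH(1)[of k l \<zeta>] PApp.IH(2)[of k l \<zeta>] by (simp del: id_apply)
qed auto

lemma popen_eq_pren:
  assumes "scoped (Suc k) l t" "\<And>r. below (Suc k) r \<Longrightarrow> \<xi> r = (if r = Bound k then Free x else r)"
  shows "popen k x t = pren \<xi> id t"
  using assms
proof (induction t arbitrary: k l \<xi>)
  case (PLam t)
  have "lift_ren \<xi> r = (if r = Bound (Suc k) then Free x else r)" if "below (Suc (Suc k)) r" for r
    using that PLam.prems(2) by (cases r rule: ref_cases) (auto split: if_splits elim: shift.elims)
  then show ?case using PLam.prems(1) by (auto simp del: id_apply intro!: PLam.IH)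
next
  case (PMu t)
  from PMu.prems show ?case by (auto simp del: id_apply intro!: PMu.IH)
next
  case (PApp t u)
  then show ?case using PApp.IH(1)[of k l \<xi>] PApp.IH(2)[of k l \<xi>] by (simp del: id_apply)
qed auto

lemma pmopen_eq_pren:
  assumes "scoped k (Suc l) t" "\<And>r. below (Suc l) r \<Longrightarrow> \<zeta> r = (if r = Bound l then Free \<alpha> else r)"
  shows "pmopen l \<alpha> t = pren id \<zeta> t"
  using assms
proof (induction t arbitrary: k l \<zeta>)
  case (PMu t)
  have "lift_ren \<zeta> r = (if r = Bound (Suc l) then Free \<alpha> else r)" if "below (Suc (Suc l)) r" for r
    using that PMu.prems(2) by (cases r rule: ref_cases) (auto split: if_splits elim: shift.elims)
  then show ?case using PMu.prems(1) by (auto simp del: id_apply intro!: PMu.IH)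
next
  case (PLam t)
  from PLam.prems show ?case by (auto simp del: id_apply intro!: PLam.IH)
next
  case (PApp t u)
  then show ?case using PApp.IH(1)[of k l \<zeta>] PApp.IH(2)[of k l \<zeta>] by (simp del: id_apply)
qed auto

text \<open>Unlike \<open>bind_ref 0 x\<close> this also shifts the dangling indices, which makes it
  fit the split into \<open>Bound 0\<close> and shifts. The two agree on free names, hence on
  preterms without dangling indices.\<close>

definition bind0 :: "'v \<Rightarrow> 'v ref \<Rightarrow> 'v ref" where
  "bind0 x r = (if r = Free x then Bound 0 else shift r)"

lemma below_0: "below 0 r \<longleftrightarrow> (\<exists>x. r = Free x)"
  by (cases r) auto

lemma pbind0: "scoped 0 0 t \<Longrightarrow> pbind 0 x t = pren (bind0 x) id t"
  by (erule pbind_eq_pren) (auto simp: below_0 bind_ref_def bind0_def)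

lemma pmbind0: "scoped 0 0 t \<Longrightarrow> pmbind 0 \<alpha> t = pren id (bind0 \<alpha>) t"
  by (erule pmbind_eq_pren) (auto simp: below_0 bind_ref_def bind0_def)

lemma popen0:
  assumes "scoped (Suc 0) 0 t"
  shows "popen 0 x t = pren (scons (Free x) id) id t"
proof (rule popen_eq_pren[OF assms])
  show "scons (Free x) id r = (if r = Bound 0 then Free x else r)" if "below (Suc 0) r" for r
    using that by (cases r) auto
qed

lemma pmopen0:
  assumes "scoped 0 (Suc 0) t"
  shows "pmopen 0 \<alpha> t = pren id (scons (Free \<alpha>) id) t"
proof (rule pmopen_eq_pren[OF assms])
  show "scons (Free \<alpha>) id r = (if r = Bound 0 then Free \<alpha> else r)" if "below (Suc 0) r" for r
    using that by (cases r) auto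
qed

lemma pren_closed: "scoped 0 0 v \<Longrightarrow> (\<And>x. \<xi> (Free x) = Free x) \<Longrightarrow>
    (\<And>\<alpha>. \<zeta> (Free \<alpha>) = Free \<alpha>) \<Longrightarrow> pren \<xi> \<zeta> v = v"
  by (erule pren_scoped_id) (auto simp: below_0)

text \<open>\<open>psubst\<close> never lifts \<open>v\<close> under a binder. Since
  \<open>v\<close> has no dangling indices, shifts leave it fixed, and so lifting does not change
  the parallel substitution either.\<close>

lemma psubst_eq_psub:
  assumes "scoped 0 0 v"
  shows "psubst x v t = psub (\<lambda>r. if r = Free x then v else PVar r) no_msub t"
proof (induction t)
  case (PLam t)
  have "lift_sub (\<lambda>r. if r = Free x then v else PVar r) = (\<lambda>r. if r = Free x then v else PVar r)"
    unfolding lift_sub_def using assms by (intro scons_eqI) (auto simp: pren_closed)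
  then show ?case by (simp add: PLam map_prod_no_args del: comp_apply)
next
  case (PMu t)
  have "shift_mu \<circ> (\<lambda>r. if r = Free x then v else PVar r) = (\<lambda>r. if r = Free x then v else PVar r)"
    using assms by (auto simp: pren_closed)
  then show ?case by (simp add: PMu lift_msub_id del: comp_apply)
qed auto

lemma pmsubst_eq_psub:
  assumes "scoped 0 0 v"
  shows "pmsubst \<alpha> v t = psub PVar (\<lambda>r. (r, if r = Free \<alpha> then [v] else [])) t"
proof (induction t)
  case (PLam t)
  have "map_prod id (map shift_lam) \<circ> (\<lambda>r. (r, if r = Free \<alpha> then [v] else [])) =
      (\<lambda>r. (r, if r = Free \<alpha> then [v] else []))"
    using assms by (auto simp: pren_closed)
  then show ?case by (simp add: PLam lift_sub_id del: comp_apply)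
next
  case (PMu t)
  have "lift_msub (\<lambda>r. (r, if r = Free \<alpha> then [v] else [])) = (\<lambda>r. (r, if r = Free \<alpha> then [v] else []))"
    unfolding lift_msub_def using assms by (intro scons_eqI) (auto simp: pren_closed)
  then show ?case by (simp add: PMu pren_comp_PVar del: comp_apply)
qed (auto simp: PApps_def)

lemma inst_lam_pbind:
  assumes "scoped 0 0 u" "scoped 0 0 v"
  shows "inst_lam v (pbind 0 x u) = psubst x v u"
proof -
  have "scons v PVar \<circ> bind0 x = (\<lambda>r. if r = Free x then v else PVar r)"
    by (auto simp: bind0_def)
  then show ?thesis
    using assms
    by (simp add: inst_lam_def pbind0 psub_pren psubst_eq_psub comp_def[of no_msub])
qed

text \<open>Binding \<open>\<alpha>\<close> after the substitution would also bind it inside the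
  inserted copies of \<open>v\<close>; freshness of \<open>\<alpha>\<close> for \<open>v\<close>
  rules this out.\<close>

lemma inst_mu_pmbind:
  assumes "scoped 0 0 u" "scoped 0 0 v" "\<alpha> \<notin> pfmv v"
  shows "inst_mu v (pmbind 0 \<alpha> u) = pmbind 0 \<alpha> (pmsubst \<alpha> v u)"
proof -
  have "pren id (bind0 \<alpha>) v = v" "shift_mu v = v"
    using assms pmbind_fresh[of \<alpha> v 0] by (auto simp: pmbind0 pren_closed)
  then have "scons (Bound 0, [shift_mu v]) (\<lambda>r. (shift r, [])) \<circ> bind0 \<alpha> =
      map_prod (bind0 \<alpha>) (map (pren id (bind0 \<alpha>))) \<circ> (\<lambda>r. (r, if r = Free \<alpha> then [v] else []))"
    by (auto simp: bind0_def)
  moreover have "pmbind 0 \<alpha> (pmsubst \<alpha> v u) = pren id (bind0 \<alpha>) (pmsubst \<alpha> v u)"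
    using assms by (intro pmbind0 scoped_pmsubst)
  ultimately show ?thesis
    using assms
    by (simp add: inst_mu_def pmbind0 psub_pren pmsubst_eq_psub pren_psub
        pren_comp_PVar del: comp_apply)
qed

section \<open>Transfer of reduction between terms and preterms\<close>

lemma scoped_Rep [simp]: "scoped 0 0 (Rep_trm t)"
  using Rep_trm[of t] by simp

lemma pstep_pren: "pstep p q \<Longrightarrow> pstep (pren \<xi> \<zeta> p) (pren \<xi> \<zeta> q)"
proof (induction arbitrary: \<xi> \<zeta> rule: pstep.induct)
  case (beta u v)
  then show ?case by (simp add: pren_inst_lam pstep.beta)
next
  case (mu u v)
  then show ?case by (simp add: pren_inst_mu pstep.mu)
qed (auto intro: pstep.intros)

lemma red_imp_pstep: "t \<triangleright> t' \<Longrightarrow> pstep (Rep_trm t) (Rep_trm t')"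
proof (induction rule: red.induct)
  case (beta x u v)
  then show ?case
    using pstep.beta[of "pbind 0 x (Rep_trm u)" "Rep_trm v"]
    by (simp add: App.rep_eq Lam.rep_eq subst.rep_eq inst_lam_pbind)
next
  case (mu \<alpha> v u)
  then show ?case
    using pstep.mu[of "pmbind 0 \<alpha> (Rep_trm u)" "Rep_trm v"]
    by (simp add: App.rep_eq Mu.rep_eq msubst.rep_eq inst_mu_pmbind fmv.rep_eq)
next
  case (lam_cong t t' x)
  then show ?case by (simp add: Lam.rep_eq pbind0 pstep_pren pstep.lam_cong)
next
  case (mu_cong t t' \<alpha>)
  then show ?case by (simp add: Mu.rep_eq pmbind0 pstep_pren pstep.mu_cong)
qed (simp_all add: App.rep_eq Named.rep_eq pstep.intros)

lemma reds_imp_psteps: "t \<triangleright>\<^sup>* t' \<Longrightarrow> pstep\<^sup>*\<^sup>* (Rep_trm t) (Rep_trm t')"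
  by (induction rule: rtranclp_induct) (auto dest: red_imp_pstep)

lemma Abs_PLam:
  assumes "scoped (Suc 0) 0 q" "x \<notin> pfv q"
  shows "Abs_trm (PLam q) = Lam x (Abs_trm (pren (scons (Free x) id) id q))"
proof -
  have "scoped 0 0 (pren (scons (Free x) id) id q)"
    using scoped_popen[OF assms(1)] assms(1) by (simp add: popen0)
  then show ?thesis
    using pbind_popen[OF assms(2), of 0] assms(1) by (simp add: Lam_def Abs_trm_inverse popen0)
qed

lemma Abs_PMu:
  assumes "scoped 0 (Suc 0) q" "\<alpha> \<notin> pfmv q"
  shows "Abs_trm (PMu q) = Mu \<alpha> (Abs_trm (pren id (scons (Free \<alpha>) id) q))"
proof -
  have "scoped 0 0 (pren id (scons (Free \<alpha>) id) q)"
    using scoped_pmopen[OF assms(1)] assms(1) by (simp add: pmopen0)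
  then show ?thesis
    using pmbind_pmopen[OF assms(2), of 0] assms(1) by (simp add: Mu_def Abs_trm_inverse pmopen0)
qed

lemma Abs_PApp: "scoped 0 0 t \<Longrightarrow> scoped 0 0 u \<Longrightarrow> Abs_trm (PApp t u) = App (Abs_trm t) (Abs_trm u)"
  by (simp add: App_def Abs_trm_inverse)

lemma Abs_PNamed: "scoped 0 0 t \<Longrightarrow> Abs_trm (PNamed (Free \<alpha>) t) = Named \<alpha> (Abs_trm t)"
  by (simp add: Named_def Abs_trm_inverse)

lemma scoped_pren_range:
  "(\<And>r. below k (\<xi> r)) \<Longrightarrow> (\<And>r. below l (\<zeta> r)) \<Longrightarrow> scoped k l (pren \<xi> \<zeta> t)"
proof (induction t arbitrary: k l \<xi> \<zeta>)
  case (PLam t)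
  have "below (Suc k) (lift_ren \<xi> r)" for r
    using PLam.prems(1) by (cases r rule: ref_cases) auto
  then show ?case using PLam by auto
next
  case (PMu t)
  have "below (Suc l) (lift_ren \<zeta> r)" for r
    using PMu.prems(2) by (cases r rule: ref_cases) auto
  then show ?case using PMu by auto
qed auto

lemma scons_comp_lift_ren: "scons a id \<circ> lift_ren \<xi> = scons a \<xi>"
  by (rule ext, rename_tac r, case_tac r rule: ref_cases) auto

lemma below_lift_ren: "(\<And>r. below k (\<xi> r)) \<Longrightarrow> below (Suc k) (lift_ren \<xi> r)"
  by (cases r rule: ref_cases) auto

lemma below_scons: "below k a \<Longrightarrow> (\<And>r. below k (\<xi> r)) \<Longrightarrow> below k (scons a \<xi> r)"
  by (cases r rule: ref_cases) auto

text \<open>\<open>Abs_trm\<close> is meaningful only without dangling indices, but the body of an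
  abstraction may have them. The induction therefore quantifies over renamings that send every
  reference to a free name; below a binder such a renaming is extended by a fresh name.\<close>

lemma pstep_closing_imp_red:
  fixes p q :: "('x :: infinite, 'm :: infinite) ptrm"
    and \<xi> :: "'x ref \<Rightarrow> 'x ref" and \<zeta> :: "'m ref \<Rightarrow> 'm ref"
  assumes "pstep p q" "\<And>r. below 0 (\<xi> r)" "\<And>r. below 0 (\<zeta> r)"
  shows "Abs_trm (pren \<xi> \<zeta> p) \<triangleright> Abs_trm (pren \<xi> \<zeta> q)"
  using assms
proof (induction arbitrary: \<xi> \<zeta> rule: pstep.induct)
  case (beta u v)
  let ?u = "pren (lift_ren \<xi>) \<zeta> u" and ?v = "pren \<xi> \<zeta> v"
  have sc: "scoped (Suc 0) 0 ?u" "scoped 0 0 ?v"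
    using beta.prems by (auto intro!: scoped_pren_range below_lift_ren)
  obtain x where x: "x \<notin> pfv ?u"
    using ex_fresh(1)[of ?u ?u] by blast
  have sco: "scoped 0 0 (popen 0 x ?u)" using sc by (simp add: scoped_popen)
  have "App (Lam x (Abs_trm (popen 0 x ?u))) (Abs_trm ?v) \<triangleright>
      (Abs_trm (popen 0 x ?u))[x ::= Abs_trm ?v]"
    by (rule red.beta)
  moreover have "(Abs_trm (popen 0 x ?u))[x ::= Abs_trm ?v] = Abs_trm (inst_lam ?v ?u)"
    using sc sco x inst_lam_pbind[OF sco sc(2), of x]
    by (simp add: subst_def Abs_trm_inverse pbind_popen)
  ultimately show ?case
    using sc x by (simp add: Abs_PApp Abs_PLam[where x = x] popen0 pren_inst_lam)
next
  case (mu u v)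
  let ?u = "pren \<xi> (lift_ren \<zeta>) u" and ?v = "pren \<xi> \<zeta> v"
  have sc: "scoped 0 (Suc 0) ?u" "scoped 0 0 ?v"
    using mu.prems by (auto intro!: scoped_pren_range below_lift_ren)
  obtain \<alpha> where \<alpha>: "\<alpha> \<notin> pfmv ?u" "\<alpha> \<notin> pfmv ?v"
    using ex_fresh(2)[of ?u ?v] by blast
  have sco: "scoped 0 0 (pmopen 0 \<alpha> ?u)" using sc by (simp add: scoped_pmopen)
  have "App (Mu \<alpha> (Abs_trm (pmopen 0 \<alpha> ?u))) (Abs_trm ?v) \<triangleright>
      Mu \<alpha> ((Abs_trm (pmopen 0 \<alpha> ?u))[\<alpha> ::=* Abs_trm ?v])"
    using \<alpha> sc by (intro red.mu) (simp add: fmv_def Abs_trm_inverse)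
  moreover have "Mu \<alpha> ((Abs_trm (pmopen 0 \<alpha> ?u))[\<alpha> ::=* Abs_trm ?v]) = Abs_trm (PMu (inst_mu ?v ?u))"
    using sc sco \<alpha> inst_mu_pmbind[OF sco sc(2), of \<alpha>]
    by (simp add: msubst_def Mu_def Abs_trm_inverse pmbind_pmopen scoped_pmsubst)
  ultimately show ?case
    using sc \<alpha> by (simp add: Abs_PApp Abs_PMu[where \<alpha> = \<alpha>] pmopen0 pren_inst_mu)
next
  case (lam_cong t t')
  let ?t = "pren (lift_ren \<xi>) \<zeta> t" and ?t' = "pren (lift_ren \<xi>) \<zeta> t'"
  have sc: "scoped (Suc 0) 0 ?t" "scoped (Suc 0) 0 ?t'"
    using lam_cong.prems by (auto intro!: scoped_pren_range below_lift_ren)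
  obtain x where x: "x \<notin> pfv ?t" "x \<notin> pfv ?t'"
    using ex_fresh(1)[of ?t ?t'] by blast
  have "Abs_trm (pren (scons (Free x) \<xi>) \<zeta> t) \<triangleright> Abs_trm (pren (scons (Free x) \<xi>) \<zeta> t')"
    using lam_cong.prems by (intro lam_cong.IH below_scons) auto
  then show ?case
    using sc x by (simp add: Abs_PLam[where x = x] pren_pren scons_comp_lift_ren red.lam_cong)
next
  case (mu_cong t t')
  let ?t = "pren \<xi> (lift_ren \<zeta>) t" and ?t' = "pren \<xi> (lift_ren \<zeta>) t'"
  have sc: "scoped 0 (Suc 0) ?t" "scoped 0 (Suc 0) ?t'"
    using mu_cong.prems by (auto intro!: scoped_pren_range below_lift_ren)
  obtain \<alpha> where \<alpha>: "\<alpha> \<notin> pfmv ?t" "\<alpha> \<notin> pfmv ?t'"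
    using ex_fresh(2)[of ?t ?t'] by blast
  have "Abs_trm (pren \<xi> (scons (Free \<alpha>) \<zeta>) t) \<triangleright> Abs_trm (pren \<xi> (scons (Free \<alpha>) \<zeta>) t')"
    using mu_cong.prems by (intro mu_cong.IH below_scons) auto
  then show ?case
    using sc \<alpha> by (simp add: Abs_PMu[where \<alpha> = \<alpha>] pren_pren scons_comp_lift_ren red.mu_cong)
next
  case (app_cong1 t t' u)
  then show ?case by (simp add: Abs_PApp scoped_pren_range red.app_cong1)
next
  case (app_cong2 u u' t)
  then show ?case by (simp add: Abs_PApp scoped_pren_range red.app_cong2)
next
  case (named_cong t t' r)
  from named_cong.prems(2)[of r] obtain \<alpha> where "\<zeta> r = Free \<alpha>" by (auto simp: below_0)
  with named_cong show ?case by (simp add: Abs_PNamed scoped_pren_range red.named_cong)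
qed

text \<open>A closing renaming that fixes all preterms without dangling indices; the name given to
  indices is a dummy value.\<close>

fun free_or :: "'v \<Rightarrow> 'v ref \<Rightarrow> 'v ref" where
  "free_or y (Free x) = Free x"
| "free_or y (Bound i) = Free y"

lemma below_free_or [simp]: "below k (free_or y r)"
  by (cases r) auto

lemma pren_free_or [simp]: "scoped 0 0 t \<Longrightarrow> pren (free_or y) (free_or z) t = t"
  by (erule pren_closed) auto

lemma scoped_pstep: "pstep p q \<Longrightarrow> scoped k l p \<Longrightarrow> scoped k l q"
proof (induction arbitrary: k l rule: pstep.induct)
  case (beta u v)
  have "scoped k l (scons v PVar r)" if "below (Suc k) r" for r
    using that beta by (cases r rule: ref_cases) auto
  with beta show ?case
    unfolding inst_lam_def by (intro scoped_psub[where k = "Suc k" and l = l]) auto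
next
  case (mu u v)
  let ?g = "scons (Bound 0, [shift_mu v]) (\<lambda>r. (shift r, []))"
  have "below (Suc l) (fst (?g r))" if "below (Suc l) r" for r
    using that by (cases r rule: ref_cases) auto
  moreover have "scoped k (Suc l) w" if "w \<in> set (snd (?g r))" for r w
    using that mu by (cases r rule: ref_cases) (auto intro!: scoped_pren)
  ultimately show ?case
    using mu unfolding inst_mu_def scoped.simps
    by (intro scoped_psub[where k = k and l = "Suc l"]) auto
qed auto

lemma pstep_imp_red:
  fixes p q :: "('x :: infinite, 'm :: infinite) ptrm"
  assumes "pstep p q" "scoped 0 0 p"
  shows "Abs_trm p \<triangleright> Abs_trm q"
  using pstep_closing_imp_red[OF assms(1), of "free_or undefined" "free_or undefined"]
    scoped_pstep[OF assms] assms(2) by simp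

lemma psteps_imp_reds:
  fixes p q :: "('x :: infinite, 'm :: infinite) ptrm"
  assumes "pstep\<^sup>*\<^sup>* p q" "scoped 0 0 p"
  shows "Abs_trm p \<triangleright>\<^sup>* Abs_trm q \<and> scoped 0 0 q"
  using assms
proof (induction rule: rtranclp_induct)
  case (step q r)
  then have "scoped 0 0 q" "Abs_trm p \<triangleright>\<^sup>* Abs_trm q" by auto
  with step.hyps(2) show ?case
    using pstep_imp_red[of q r] scoped_pstep[of q r] by (auto intro: rtranclp.rtrancl_into_rtrancl)
qed auto

section \<open>Typing with contexts on references\<close>

inductive ptyping ::
    "('x ref \<Rightarrow> 'p ty option) \<Rightarrow> ('m ref \<Rightarrow> 'p ty option) \<Rightarrow> ('x, 'm) ptrm \<Rightarrow> 'p ty \<Rightarrow> bool" where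
  ax: "\<Gamma> r = Some A \<Longrightarrow> ptyping \<Gamma> \<Delta> (PVar r) A"
| fun_i: "ptyping (scons (Some A) \<Gamma>) \<Delta> t B \<Longrightarrow> ptyping \<Gamma> \<Delta> (PLam t) (A \<rightarrow> B)"
| fun_e: "ptyping \<Gamma> \<Delta> u (A \<rightarrow> B) \<Longrightarrow> ptyping \<Gamma> \<Delta> v A \<Longrightarrow> ptyping \<Gamma> \<Delta> (PApp u v) B"
| mu: "ptyping \<Gamma> (scons (Some A) \<Delta>) t Bot \<Longrightarrow> ptyping \<Gamma> \<Delta> (PMu t) A"
| bot: "\<Delta> r = Some A \<Longrightarrow> ptyping \<Gamma> \<Delta> t A \<Longrightarrow> ptyping \<Gamma> \<Delta> (PNamed r t) Bot"

inductive_cases ptyping_PVarE: "ptyping \<Gamma> \<Delta> (PVar r) A"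
inductive_cases ptyping_PLamE: "ptyping \<Gamma> \<Delta> (PLam t) A"
inductive_cases ptyping_PAppE: "ptyping \<Gamma> \<Delta> (PApp t u) A"
inductive_cases ptyping_PMuE: "ptyping \<Gamma> \<Delta> (PMu t) A"
inductive_cases ptyping_PNamedE: "ptyping \<Gamma> \<Delta> (PNamed r t) A"

lemma ptyping_pren:
  assumes "ptyping \<Gamma> \<Delta> t A"
    and "\<And>r B. \<Gamma> r = Some B \<Longrightarrow> \<Gamma>' (\<xi> r) = Some B"
    and "\<And>r B. \<Delta> r = Some B \<Longrightarrow> \<Delta>' (\<zeta> r) = Some B"
  shows "ptyping \<Gamma>' \<Delta>' (pren \<xi> \<zeta> t) A"
  using assms
proof (induction arbitrary: \<Gamma>' \<Delta>' \<xi> \<zeta> rule: ptyping.induct)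
  case (fun_i A \<Gamma> \<Delta> t B)
  have "scons (Some A) \<Gamma>' (lift_ren \<xi> r) = Some C" if "scons (Some A) \<Gamma> r = Some C" for r C
    using that fun_i.prems(1) by (cases r rule: ref_cases) auto
  with fun_i show ?case by (auto intro!: ptyping.fun_i)
next
  case (mu \<Gamma> A \<Delta> t)
  have "scons (Some A) \<Delta>' (lift_ren \<zeta> r) = Some C" if "scons (Some A) \<Delta> r = Some C" for r C
    using that mu.prems(2) by (cases r rule: ref_cases) auto
  with mu show ?case by (auto intro!: ptyping.mu)
next
  case (fun_e \<Gamma> \<Delta> u A B v)
  show ?case
    unfolding pren.simps
    by (rule ptyping.fun_e[OF fun_e.IH(1) fun_e.IH(2)]) (use fun_e.prems in auto)
qed (auto intro: ptyping.intros)

fun ctx_of :: "('v \<rightharpoonup> 'p ty) \<Rightarrow> 'v ref \<Rightarrow> 'p ty option" where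
  "ctx_of \<Gamma> (Free x) = \<Gamma> x"
| "ctx_of \<Gamma> (Bound i) = None"

lemma ctx_of_bind0: "ctx_of (\<Gamma>(x \<mapsto> A)) r = Some B \<Longrightarrow> scons (Some A) (ctx_of \<Gamma>) (bind0 x r) = Some B"
  by (cases r) (auto simp: bind0_def split: if_splits)

lemma typing_imp_ptyping: "\<Gamma> \<turnstile> t : A ; \<Delta> \<Longrightarrow> ptyping (ctx_of \<Gamma>) (ctx_of \<Delta>) (Rep_trm t) A"
proof (induction rule: typing.induct)
  case (fun_i x \<Gamma> A t B \<Delta>)
  have "ptyping (scons (Some A) (ctx_of \<Gamma>)) (ctx_of \<Delta>) (pren (bind0 x) id (Rep_trm t)) B"
    by (rule ptyping_pren[OF fun_i.IH]) (auto intro: ctx_of_bind0 simp del: fun_upd_apply)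
  then show ?case by (simp add: Lam.rep_eq pbind0 ptyping.fun_i)
next
  case (mu \<alpha> \<Delta> \<Gamma> t A)
  have "ptyping (ctx_of \<Gamma>) (scons (Some A) (ctx_of \<Delta>)) (pren id (bind0 \<alpha>) (Rep_trm t)) Bot"
    by (rule ptyping_pren[OF mu.IH]) (auto intro: ctx_of_bind0 simp del: fun_upd_apply)
  then show ?case by (simp add: Mu.rep_eq pmbind0 ptyping.mu)
qed (auto simp: Var.rep_eq App.rep_eq Named.rep_eq intro: ptyping.intros)

text \<open>The closing renamings used for reduction serve again. Finite domains leave room for a
  bound name that avoids both the context, as the named rules demand, and the body.\<close>

lemma ptyping_closing_imp_typing:
  fixes \<xi> :: "'x ref \<Rightarrow> ('x :: infinite) ref" and \<zeta> :: "'m ref \<Rightarrow> ('m :: infinite) ref"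
  assumes "ptyping \<Gamma> \<Delta> t A"
    and "\<And>r. below 0 (\<xi> r)" "\<And>r. below 0 (\<zeta> r)"
    and "\<And>r B. \<Gamma> r = Some B \<Longrightarrow> \<exists>x. \<xi> r = Free x \<and> \<Gamma>' x = Some B"
    and "\<And>r B. \<Delta> r = Some B \<Longrightarrow> \<exists>\<alpha>. \<zeta> r = Free \<alpha> \<and> \<Delta>' \<alpha> = Some B"
    and "finite (dom \<Gamma>')" "finite (dom \<Delta>')"
  shows "\<Gamma>' \<turnstile> Abs_trm (pren \<xi> \<zeta> t) : A ; \<Delta>'"
  using assms
proof (induction arbitrary: \<Gamma>' \<Delta>' \<xi> \<zeta> rule: ptyping.induct)
  case (ax \<Gamma> r A \<Delta>)
  from ax.prems(3)[OF ax.hyps] obtain x where "\<xi> r = Free x" "\<Gamma>' x = Some A" by auto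
  then show ?case using typing.ax[of \<Gamma>' x A \<Delta>'] by (simp add: Var_def)
next
  case (fun_i A \<Gamma> \<Delta> t B)
  let ?t = "pren (lift_ren \<xi>) \<zeta> t"
  have sc: "scoped (Suc 0) 0 ?t"
    using fun_i.prems by (auto intro!: scoped_pren_range below_lift_ren)
  obtain x where x: "x \<notin> pfv ?t" "x \<notin> dom \<Gamma>'"
    using ex_new_if_finite[OF infinite_UNIV, of "pfv ?t \<union> dom \<Gamma>'"] fun_i.prems(5)
    by (auto simp: finite_pfv)
  have "\<exists>y. scons (Free x) \<xi> r = Free y \<and> (\<Gamma>'(x \<mapsto> A)) y = Some C"
    if "scons (Some A) \<Gamma> r = Some C" for r C
    using that x fun_i.prems(3) by (cases r rule: ref_cases) fastforce+
  with fun_i.prems have "\<Gamma>'(x \<mapsto> A) \<turnstile> Abs_trm (pren (scons (Free x) \<xi>) \<zeta> t) : B ; \<Delta>'"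
    by (intro fun_i.IH below_scons) (auto simp del: fun_upd_apply)
  with x sc show ?case
    by (simp add: Abs_PLam[where x = x] pren_pren scons_comp_lift_ren typing.fun_i)
next
  case (mu \<Gamma> A \<Delta> t)
  let ?t = "pren \<xi> (lift_ren \<zeta>) t"
  have sc: "scoped 0 (Suc 0) ?t"
    using mu.prems by (auto intro!: scoped_pren_range below_lift_ren)
  obtain \<alpha> where \<alpha>: "\<alpha> \<notin> pfmv ?t" "\<alpha> \<notin> dom \<Delta>'"
    using ex_new_if_finite[OF infinite_UNIV, of "pfmv ?t \<union> dom \<Delta>'"] mu.prems(6)
    by (auto simp: finite_pfmv)
  have "\<exists>\<beta>. scons (Free \<alpha>) \<zeta> r = Free \<beta> \<and> (\<Delta>'(\<alpha> \<mapsto> A)) \<beta> = Some C"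
    if "scons (Some A) \<Delta> r = Some C" for r C
    using that \<alpha> mu.prems(4) by (cases r rule: ref_cases) fastforce+
  with mu.prems have "\<Gamma>' \<turnstile> Abs_trm (pren \<xi> (scons (Free \<alpha>) \<zeta>) t) : Bot ; \<Delta>'(\<alpha> \<mapsto> A)"
    by (intro mu.IH below_scons) (auto simp del: fun_upd_apply)
  with \<alpha> sc show ?case
    by (simp add: Abs_PMu[where \<alpha> = \<alpha>] pren_pren scons_comp_lift_ren typing.mu)
next
  case (fun_e \<Gamma> \<Delta> u A B v)
  then show ?case by (auto simp: Abs_PApp scoped_pren_range intro!: typing.fun_e)
next
  case (bot \<Delta> r A \<Gamma> t)
  from bot.prems(4)[OF bot.hyps(1)] obtain \<alpha> where \<alpha>: "\<zeta> r = Free \<alpha>" "\<Delta>' \<alpha> = Some A"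
    by auto
  moreover have "\<Gamma>' \<turnstile> Abs_trm (pren \<xi> \<zeta> t) : A ; \<Delta>'"
    using bot.prems by (intro bot.IH) auto
  ultimately show ?case
    using bot.prems by (simp add: Abs_PNamed scoped_pren_range typing.bot)
qed

lemma names_shift [simp]: "names (shift r) = names r"
  by (cases r) auto

text \<open>An index carries no name, so the inclusions restrict only the free names, namely to
  those that occur. In particular a closed term can be retyped in empty contexts.\<close>

lemma ptyping_cong_closed:
  assumes "ptyping \<Gamma> \<Delta> t A" "scoped k l t"
    and "\<And>r. below k r \<Longrightarrow> names r \<subseteq> pfv t \<Longrightarrow> \<Gamma>' r = \<Gamma> r"
    and "\<And>r. below l r \<Longrightarrow> names r \<subseteq> pfmv t \<Longrightarrow> \<Delta>' r = \<Delta> r"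
  shows "ptyping \<Gamma>' \<Delta>' t A"
  using assms
proof (induction arbitrary: k l \<Gamma>' \<Delta>' rule: ptyping.induct)
  case (fun_i A \<Gamma> \<Delta> t B)
  have "scons (Some A) \<Gamma>' r = scons (Some A) \<Gamma> r" if "below (Suc k) r" "names r \<subseteq> pfv t" for r
    using that fun_i.prems(2) by (cases r rule: ref_cases) auto
  with fun_i show ?case by (auto intro!: ptyping.fun_i fun_i.IH[of "Suc k" l])
next
  case (mu \<Gamma> A \<Delta> t)
  have "scons (Some A) \<Delta>' r = scons (Some A) \<Delta> r" if "below (Suc l) r" "names r \<subseteq> pfmv t" for r
    using that mu.prems(3) by (cases r rule: ref_cases) auto
  with mu show ?case by (auto intro!: ptyping.mu mu.IH[of k "Suc l"])
next
  case (fun_e \<Gamma> \<Delta> u A B v)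
  show ?case
    by (rule ptyping.fun_e[OF fun_e.IH(1)[of k l] fun_e.IH(2)[of k l]]) (use fun_e.prems in auto)
next
  case (bot \<Delta> r A \<Gamma> t)
  show ?case
    by (rule ptyping.bot[OF _ bot.IH[of k l]]) (use bot.hyps(1) bot.prems in auto)
qed (auto intro: ptyping.intros)

lemma ptyping_imp_typing_closed:
  fixes t :: "('x :: infinite, 'm :: infinite) trm"
  assumes "ptyping \<Gamma> \<Delta> (Rep_trm t) A" "closed_trm t"
  shows "Map.empty \<turnstile> t : A ; Map.empty"
proof -
  have "pfv (Rep_trm t) = {}" "pfmv (Rep_trm t) = {}"
    using assms(2) by (auto simp: closed_trm_def fv.rep_eq fmv.rep_eq)
  then have "ptyping (\<lambda>_. None) (\<lambda>_. None) (Rep_trm t) A"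
    using assms(1) by (auto simp: below_0 intro!: ptyping_cong_closed[of \<Gamma> \<Delta> _ _ 0 0])
  then have "Map.empty \<turnstile> Abs_trm (pren (free_or undefined) (free_or undefined) (Rep_trm t)) : A ; Map.empty"
    by (rule ptyping_closing_imp_typing) auto
  then show ?thesis by (simp add: Rep_trm_inverse)
qed

section \<open>Soundness\<close>

lemma scons_comp_shift: "scons a h \<circ> shift = h"
  by auto

text \<open>Contracting after substituting amounts to one parallel substitution with
  \<open>v\<close> at index 0, the form to which an induction hypothesis about the body
  applies.\<close>

lemma inst_lam_psub:
  "inst_lam v (psub (lift_sub f) (map_prod id (map shift_lam) \<circ> g) t) = psub (scons v f) g t"
proof -
  have inst: "psub (scons v PVar) no_msub (shift_lam u) = u" for u
    by (simp add: psub_pren scons_comp_shift psub_id comp_def[of no_msub] del: comp_apply)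
  have "psub (scons v PVar) no_msub \<circ> lift_sub f = scons v f"
    by (rule scons_eqI[symmetric]) (auto simp: inst)
  moreover have "comp_msub (scons v PVar) no_msub (map_prod id (map shift_lam) \<circ> g) = g"
    by (auto simp: fun_eq_iff comp_msub_def inst comp_def)
  ultimately show ?thesis by (simp add: inst_lam_def psub_psub)
qed

text \<open>\<open>lift_msub\<close> with a free choice at index 0, used to record the arguments
  that a \<open>\<mu>\<close>-abstraction has already absorbed.\<close>

definition enter_mu :: "'n ref \<times> ('y, 'n) ptrm list \<Rightarrow>
    ('m ref \<Rightarrow> 'n ref \<times> ('y, 'n) ptrm list) \<Rightarrow> 'm ref \<Rightarrow> 'n ref \<times> ('y, 'n) ptrm list" where
  "enter_mu a g = scons a (map_prod shift (map shift_mu) \<circ> g)"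

lemma inst_mu_psub:
  "inst_mu v (psub (shift_mu \<circ> f) (enter_mu (Bound 0, map shift_mu us) g) t) =
   psub (shift_mu \<circ> f) (enter_mu (Bound 0, map shift_mu (us @ [v])) g) t"
proof -
  let ?g = "scons (Bound 0, [shift_mu v]) (\<lambda>r. (shift r, []))"
  have inst: "psub PVar ?g (shift_mu u) = shift_mu u" for u
    using psub_ren[of id shift u] by (simp add: psub_pren scons_comp_shift del: comp_apply)
  have "psub PVar ?g \<circ> (shift_mu \<circ> f) = shift_mu \<circ> f"
    by (auto simp: inst)
  moreover have "comp_msub PVar ?g (enter_mu (Bound 0, map shift_mu us) g) =
      enter_mu (Bound 0, map shift_mu (us @ [v])) g"
    unfolding enter_mu_def
    by (rule scons_eqI[symmetric]) (auto simp: comp_msub_def inst comp_def prod_eq_iff)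
  ultimately show ?thesis by (simp add: inst_mu_def psub_psub)
qed

lemma psteps_PApp_fun: "pstep\<^sup>*\<^sup>* t t' \<Longrightarrow> pstep\<^sup>*\<^sup>* (PApp t u) (PApp t' u)"
  by (induction rule: rtranclp_induct) (auto intro: pstep.app_cong1 rtranclp.rtrancl_into_rtrancl)

text \<open>Each argument costs one \<open>\<mu>\<close>-step, which by \<open>inst_mu_psub\<close>
  lengthens the list at index 0 by one.\<close>

lemma psteps_PMu_PApps:
  "pstep\<^sup>*\<^sup>* (PApps (psub f g (PMu t)) us)
     (PMu (psub (shift_mu \<circ> f) (enter_mu (Bound 0, map shift_mu us) g) t))"
proof (induction us rule: rev_induct)
  case Nil
  then show ?case by (simp add: lift_msub_def enter_mu_def del: comp_apply id_apply)
next
  case (snoc u us)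
  have "pstep\<^sup>*\<^sup>* (PApps (psub f g (PMu t)) (us @ [u]))
      (PApp (PMu (psub (shift_mu \<circ> f) (enter_mu (Bound 0, map shift_mu us) g) t)) u)"
    using psteps_PApp_fun[OF snoc] by (simp add: PApps_def del: comp_apply id_apply)
  with pstep.mu show ?case
    by (metis inst_mu_psub rtranclp.rtrancl_into_rtrancl)
qed

text \<open>Opening the binder cancels the shifts, so the absorbed arguments become an ordinary
  value of the substitution at index 0, with a name \<open>b\<close> that can be chosen after the
  reduction.\<close>

lemma pren_enter_mu:
  "pren id (scons b id) (psub (shift_mu \<circ> f) (enter_mu (Bound 0, map shift_mu us) g) t) =
   psub f (scons (b, us) g) t"
proof -
  have inst: "pren id (scons b id) (shift_mu u) = u" for u :: "('a, 'b) ptrm"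
    by (simp add: pren_pren scons_comp_shift del: comp_apply)
  have "pren id (scons b id) \<circ> (shift_mu \<circ> f) = f" by (auto simp: inst)
  moreover have "map_prod (scons b id) (map (pren id (scons b id))) \<circ>
      enter_mu (Bound 0, map shift_mu us) g = scons (b, us) g"
    unfolding enter_mu_def
    by (rule scons_eqI[symmetric]) (auto simp: inst comp_def prod_eq_iff)
  ultimately show ?thesis by (simp add: pren_psub)
qed

lemma Apps_simps [simp]: "Apps t [] = t" "Apps t (us @ vs) = Apps (Apps t us) vs"
  by (simp_all add: Apps_def)

lemma Apps_Cons: "Apps t (u # us) = Apps (App t u) us"
  by (simp add: Apps_def)

lemma Abs_PApps:
  "scoped 0 0 t \<Longrightarrow> (\<And>u. u \<in> set us \<Longrightarrow> scoped 0 0 u) \<Longrightarrow>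
    Abs_trm (PApps t us) = Apps (Abs_trm t) (map Abs_trm us)"
proof (induction us arbitrary: t)
  case (Cons u us)
  then show ?case by (simp add: PApps_Cons Apps_Cons Abs_PApp)
qed simp

lemma reds_App_fun: "t \<triangleright>\<^sup>* t' \<Longrightarrow> App t u \<triangleright>\<^sup>* App t' u"
  by (induction rule: rtranclp_induct) (auto intro: red.app_cong1 rtranclp.rtrancl_into_rtrancl)

lemma reds_App_arg: "u \<triangleright>\<^sup>* u' \<Longrightarrow> App t u \<triangleright>\<^sup>* App t u'"
  by (induction rule: rtranclp_induct) (auto intro: red.app_cong2 rtranclp.rtrancl_into_rtrancl)

section \<open>The universe of a model and realizability\<close>

lemma universe_saturated:
  assumes "is_model M" "K \<in> universe M"
  shows "saturated K"
  using assms(2)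
proof induction
  case (arrow K L)
  then show ?case
    unfolding saturated_def arrow_def by (blast intro: reds_App_fun)
qed (use assms(1) in \<open>auto simp: is_model_def\<close>)

text \<open>An arrow \<open>K \<leadsto> L\<close> prefixes the argument sequences of
  \<open>L\<close> with an element of \<open>K\<close>, so the base set is inherited from the
  rightmost target.\<close>

lemma universe_seq_arrow:
  assumes "is_model M" "K \<in> universe M"
  shows "\<exists>i\<in>I_idx M. \<exists>X. K = (X \<leadsto>\<^sub>s B_fam M i)"
  using assms(2)
proof induction
  case (B i)
  have "B_fam M i = ({[]} \<leadsto>\<^sub>s B_fam M i)" by (auto simp: seq_arrow_def)
  with B show ?case by blast
next
  case (R j)
  with assms(1) show ?case by (auto simp: is_model_def)
next
  case (arrow K L)
  then obtain i X where i: "i \<in> I_idx M" "L = (X \<leadsto>\<^sub>s B_fam M i)" by blast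
  have "(K \<leadsto> L) = ({u # us | u us. u \<in> K \<and> us \<in> X} \<leadsto>\<^sub>s B_fam M i)"
    unfolding i(2) by (auto simp: arrow_def seq_arrow_def Apps_Cons) (metis Apps_Cons)
  with i(1) show ?case by blast
qed

lemma interp_in_universe: "is_model M \<Longrightarrow> is_interp M \<I> \<Longrightarrow> interp M \<I> A \<in> universe M"
  by (induction A) (auto simp: is_interp_def is_model_def intro: universe.intros)

lemma scoped_psub_range:
  assumes "\<And>r. scoped k l (f r)" "\<And>r. below l (fst (g r))"
    and "\<And>r u. u \<in> set (snd (g r)) \<Longrightarrow> scoped k l u"
  shows "scoped k l (psub f g t)"
  using assms
proof (induction t arbitrary: k l f g)
  case (PLam t)
  have "scoped (Suc k) l (lift_sub f r)" for r
    using PLam.prems(1) by (cases r rule: ref_cases) (auto intro!: scoped_pren)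
  with PLam show ?case by (auto intro!: PLam.IH scoped_pren)
next
  case (PMu t)
  have "below (Suc l) (fst (lift_msub g r))" for r
    using PMu.prems(2) by (cases r rule: ref_cases) auto
  moreover have "scoped k (Suc l) u" if "u \<in> set (snd (lift_msub g r))" for r u
    using that PMu.prems(3) by (cases r rule: ref_cases) (auto intro!: scoped_pren)
  ultimately show ?case using PMu by (auto intro!: PMu.IH scoped_pren)
qed (auto simp: scoped_PApps)

text \<open>The value assigned to a \<open>\<mu>\<close>-variable of type \<open>B\<close>: a
  realizer of \<open>B\<close> applied to \<open>us\<close> lands in \<open>B_fam M i\<close>, and
  naming the result by \<open>\<alpha>\<close> then lands in \<open>B_fam M 0\<close>.\<close>

definition msub_ok where
  "msub_ok M \<I> B a \<longleftrightarrow> (\<exists>\<alpha> us i X. a = (Free \<alpha>, us) \<and> i \<in> I_idx M \<and> \<alpha> \<in> C_fam M i \<and>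
     interp M \<I> B = (X \<leadsto>\<^sub>s B_fam M i) \<and> map Abs_trm us \<in> X)"

text \<open>The values of \<open>f\<close> and \<open>g\<close> have no dangling indices at any
  reference, declared or not, so that the substituted preterm represents a term throughout the
  induction.\<close>

lemma adequacy:
  fixes f :: "'x ref \<Rightarrow> ('x :: infinite, 'm :: infinite) ptrm"
    and g :: "'m ref \<Rightarrow> 'm ref \<times> ('x, 'm) ptrm list"
  assumes M: "is_model M" and \<I>: "is_interp M \<I>"
    and "ptyping \<Gamma> \<Delta> t A"
    and "\<And>r. scoped 0 0 (f r)" "\<And>r. below 0 (fst (g r))"
    and "\<And>r u. u \<in> set (snd (g r)) \<Longrightarrow> scoped 0 0 u"
    and "\<And>r B. \<Gamma> r = Some B \<Longrightarrow> Abs_trm (f r) \<in> interp M \<I> B"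
    and "\<And>r B. \<Delta> r = Some B \<Longrightarrow> msub_ok M \<I> B (g r)"
  shows "Abs_trm (psub f g t) \<in> interp M \<I> A"
  using assms(3-)
proof (induction arbitrary: f g rule: ptyping.induct)
  case (fun_i A \<Gamma> \<Delta> t B)
  let ?t = "psub (lift_sub f) (map_prod id (map shift_lam) \<circ> g) t"
  have sc: "scoped 0 0 (psub f g (PLam t))"
    using fun_i.prems by (intro scoped_psub_range) auto
  have "App (Abs_trm (psub f g (PLam t))) u \<in> interp M \<I> B" if u: "u \<in> interp M \<I> A" for u
  proof -
    let ?u = "Rep_trm u"
    have "Abs_trm (psub (scons ?u f) g t) \<in> interp M \<I> B"
    proof (rule fun_i.IH)
      show "scoped 0 0 (scons ?u f r)" for r
        using fun_i.prems(1) by (cases r rule: ref_cases) auto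
      show "Abs_trm (scons ?u f r) \<in> interp M \<I> C" if "scons (Some A) \<Gamma> r = Some C" for r C
        using that u fun_i.prems(4) by (cases r rule: ref_cases) (auto simp: Rep_trm_inverse)
    qed (use fun_i.prems in auto)
    moreover have "Abs_trm (PApp (PLam ?t) ?u) \<triangleright> Abs_trm (psub (scons ?u f) g t)"
      using sc pstep.beta[of ?t ?u] unfolding inst_lam_psub by (intro pstep_imp_red) auto
    ultimately have "Abs_trm (PApp (PLam ?t) ?u) \<in> interp M \<I> B"
      using universe_saturated[OF M interp_in_universe[OF M \<I>, of B]]
      unfolding saturated_def by blast
    then show ?thesis using sc by (simp add: Abs_PApp Rep_trm_inverse)
  qed
  then show ?case by (auto simp: arrow_def)
next
  case (mu \<Gamma> A \<Delta> t)
  obtain i X where i: "i \<in> I_idx M" and X: "interp M \<I> A = (X \<leadsto>\<^sub>s B_fam M i)"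
    using universe_seq_arrow[OF M interp_in_universe[OF M \<I>]] by metis
  have sc: "scoped 0 0 (psub f g (PMu t))"
    using mu.prems by (intro scoped_psub_range) auto
  have "Apps (Abs_trm (psub f g (PMu t))) us \<in> B_fam M i" if us: "us \<in> X" for us
  proof -
    let ?us = "map Rep_trm us"
    let ?t = "psub (shift_mu \<circ> f) (enter_mu (Bound 0, map shift_mu ?us) g) t"
    have scp: "scoped 0 0 (PApps (psub f g (PMu t)) ?us)"
      using sc by (auto simp: scoped_PApps simp del: psub.simps)
    note red = psteps_imp_reds[OF psteps_PMu_PApps[of f g t ?us] scp]
    \<comment> \<open>The name has to lie in \<open>C_fam M i\<close> for the closure of
      \<open>B_fam M i\<close> under \<open>\<mu>\<close>, and has to be fresh for the body so that
      binding it again restores \<open>PMu ?t\<close>.\<close>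
    have "infinite (C_fam M i)" using M i by (simp add: is_model_def)
    then obtain \<alpha> where \<alpha>: "\<alpha> \<in> C_fam M i" "\<alpha> \<notin> pfmv ?t"
      using finite_pfmv[of ?t] by (meson finite_subset subsetI)
    have "Abs_trm (psub f (scons (Free \<alpha>, ?us) g) t) \<in> interp M \<I> Bot"
    proof (rule mu.IH)
      show "below 0 (fst (scons (Free \<alpha>, ?us) g r))" for r
        using mu.prems(2) by (cases r rule: ref_cases) auto
      show "scoped 0 0 u" if "u \<in> set (snd (scons (Free \<alpha>, ?us) g r))" for r u
        using that mu.prems(3) by (cases r rule: ref_cases) auto
      show "msub_ok M \<I> C (scons (Free \<alpha>, ?us) g r)" if "scons (Some A) \<Delta> r = Some C" for r C
      proof (cases r rule: ref_cases)
        case zero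
        with that us i X \<alpha> show ?thesis
          by (auto simp: msub_ok_def comp_def Rep_trm_inverse)
      next
        case (shift s)
        with that mu.prems(5) show ?thesis by auto
      qed
    qed (use mu.prems in auto)
    then have "Mu \<alpha> (Abs_trm (psub f (scons (Free \<alpha>, ?us) g) t)) \<in> B_fam M i"
      using M i \<alpha> by (simp add: is_model_def)
    moreover have "Abs_trm (PMu ?t) = Mu \<alpha> (Abs_trm (psub f (scons (Free \<alpha>, ?us) g) t))"
      using red \<alpha> by (simp add: Abs_PMu[where \<alpha> = \<alpha>] pren_enter_mu del: map_map)
    ultimately have "Abs_trm (PApps (psub f g (PMu t)) ?us) \<in> B_fam M i"
      using red M i unfolding is_model_def saturated_def by metis
    moreover have "Abs_trm (PApps (psub f g (PMu t)) ?us) = Apps (Abs_trm (psub f g (PMu t))) us"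
      by (subst Abs_PApps[OF sc]) (auto simp: comp_def Rep_trm_inverse simp del: psub.simps)
    ultimately show ?thesis by simp
  qed
  then show ?case unfolding X by (simp add: seq_arrow_def)
next
  case (fun_e \<Gamma> \<Delta> u A B v)
  have "Abs_trm (psub f g u) \<in> interp M \<I> (A \<rightarrow> B)" "Abs_trm (psub f g v) \<in> interp M \<I> A"
    using fun_e.prems by (auto intro!: fun_e.IH simp del: interp.simps)
  then show ?case using fun_e.prems by (simp add: Abs_PApp scoped_psub_range arrow_def)
next
  case (bot \<Delta> r A \<Gamma> t)
  from bot.prems(5)[OF bot.hyps(1)] obtain \<alpha> us i X
    where a: "g r = (Free \<alpha>, us)" "i \<in> I_idx M" "\<alpha> \<in> C_fam M i"
      "interp M \<I> A = (X \<leadsto>\<^sub>s B_fam M i)" "map Abs_trm us \<in> X"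
    unfolding msub_ok_def by blast
  have sc: "scoped 0 0 (psub f g t)" "\<And>u. u \<in> set us \<Longrightarrow> scoped 0 0 u"
    using bot.prems(1-3) bot.prems(3)[of _ r] a(1) by (auto intro: scoped_psub_range)
  have "Abs_trm (psub f g t) \<in> interp M \<I> A"
    using bot.prems by (intro bot.IH) auto
  then have "Apps (Abs_trm (psub f g t)) (map Abs_trm us) \<in> B_fam M i"
    using a by (simp add: seq_arrow_def)
  then have "Named \<alpha> (Apps (Abs_trm (psub f g t)) (map Abs_trm us)) \<in> B_fam M 0"
    using M a by (simp add: is_model_def)
  then show ?case
    using sc a by (simp add: Abs_PNamed Abs_PApps scoped_PApps)
qed simp

lemma typing_imp_sem:
  fixes t :: "('x :: infinite, 'm :: infinite) trm"
  assumes "Map.empty \<turnstile> t : A ; Map.empty"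
  shows "t \<in> sem A"
proof -
  have "t \<in> interp M \<I> A" if "is_model M" "is_interp M \<I>" for M \<I>
  proof -
    have none: "ctx_of Map.empty r = None" for r :: "'v ref"
      by (cases r) auto
    \<comment> \<open>The identity substitution, except that dangling indices go to dummy names as
      \<open>adequacy\<close> requires.\<close>
    have "Abs_trm (psub (PVar \<circ> free_or undefined) (no_msub \<circ> free_or undefined) (Rep_trm t)) \<in>
        interp M \<I> A"
      using that typing_imp_ptyping[OF assms]
      by (rule adequacy) (auto simp: none)
    moreover have "psub (PVar \<circ> free_or undefined) (no_msub \<circ> free_or undefined) (Rep_trm t) = Rep_trm t"
      by (rule psub_scoped_id[of 0 0]) (auto simp: below_0)
    ultimately show ?thesis by (simp add: Rep_trm_inverse)
  qed
  then show ?thesis by (auto simp: sem_def sem_in_def)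
qed

lemma sem_saturated: "saturated (sem A)"
proof -
  have "t \<in> sem A" if "t \<triangleright>\<^sup>* t'" "t' \<in> sem A" for t t'
  proof -
    have "t \<in> interp M \<I> A" if "is_model M" "is_interp M \<I>" for M \<I>
    proof -
      have "saturated (interp M \<I> A)"
        using that universe_saturated interp_in_universe by blast
      moreover have "t' \<in> interp M \<I> A"
        using that \<open>t' \<in> sem A\<close> by (auto simp: sem_def sem_in_def)
      ultimately show ?thesis
        using \<open>t \<triangleright>\<^sup>* t'\<close> unfolding saturated_def by blast
    qed
    then show ?thesis by (auto simp: sem_def sem_in_def)
  qed
  then show ?thesis unfolding saturated_def by blast
qed

section \<open>Feeding a variable\<close>

text \<open>
  Completeness needs that a reduction of \<open>(t x)\<close> to a term \<open>w\<close> of type \<open>B\<close> yields a reduction of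
  \<open>t\<close> to a term of type \<open>A \<rightarrow> B\<close>, where \<open>x : A\<close>. Neither \<open>\<lambda>y.u\<close> nor \<open>\<mu>\<alpha>.u\<close> is recovered from \<open>w\<close> by
  putting an abstraction in front of it: \<open>(\<mu>\<alpha>.u x)\<close> pushes \<open>x\<close> to all subterms named \<open>\<alpha>\<close>, where it
  triggers further reductions. \<open>fed_arg \<rho> S t w\<close> says that \<open>w\<close> is such a stage of \<open>t\<close> applied to \<open>x\<close>,
  and \<open>fed \<rho> S t w\<close> that \<open>w\<close> arises from \<open>t\<close> by replacing each subterm \<open>(\<alpha> u)\<close> with \<open>\<alpha> \<in> S\<close> by
  \<open>(\<alpha> u')\<close> for a stage \<open>u'\<close> of \<open>(u x)\<close>. The renaming \<open>\<rho>\<close> sends to \<open>x\<close> the variables of those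
  abstractions of \<open>t\<close> which have consumed their argument \<open>x\<close> in \<open>w\<close>.
\<close>

inductive fed :: "'x \<Rightarrow> ('x ref \<Rightarrow> 'x ref) \<Rightarrow> ('m ref \<Rightarrow> bool) \<Rightarrow>
      ('x, 'm) ptrm \<Rightarrow> ('x, 'm) ptrm \<Rightarrow> bool"
  and fed_arg :: "'x \<Rightarrow> ('x ref \<Rightarrow> 'x ref) \<Rightarrow> ('m ref \<Rightarrow> bool) \<Rightarrow>
      ('x, 'm) ptrm \<Rightarrow> ('x, 'm) ptrm \<Rightarrow> bool"
  for x :: 'x where
  PVar: "fed x \<rho> S (PVar r) (PVar (\<rho> r))"
| PLam: "fed x (lift_ren \<rho>) S t t' \<Longrightarrow> fed x \<rho> S (PLam t) (PLam t')"
| PApp: "fed x \<rho> S t t' \<Longrightarrow> fed x \<rho> S u u' \<Longrightarrow> fed x \<rho> S (PApp t u) (PApp t' u')"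
| PMu: "fed x \<rho> (scons False S) t t' \<Longrightarrow> fed x \<rho> S (PMu t) (PMu t')"
| PNamed: "\<not> S r \<Longrightarrow> fed x \<rho> S t t' \<Longrightarrow> fed x \<rho> S (PNamed r t) (PNamed r t')"
| PNamed_arg: "S r \<Longrightarrow> fed_arg x \<rho> S t t' \<Longrightarrow> fed x \<rho> S (PNamed r t) (PNamed r t')"
| arg_PApp: "fed x \<rho> S t t' \<Longrightarrow> fed_arg x \<rho> S t (PApp t' (PVar (Free x)))"
| arg_PLam: "fed x (scons (Free x) \<rho>) S t t' \<Longrightarrow> fed_arg x \<rho> S (PLam t) t'"
| arg_PMu: "fed x \<rho> (scons True S) t t' \<Longrightarrow> fed_arg x \<rho> S (PMu t) (PMu t')"

inductive_cases fed_PLamE: "fed x \<rho> S t (PLam t')"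
inductive_cases fed_PMuE: "fed x \<rho> S t (PMu t')"

lemma fed_refl: "\<not> (\<exists>r. S r) \<Longrightarrow> \<rho> = id \<Longrightarrow> fed x \<rho> S t t"
proof (induction t arbitrary: S \<rho>)
  case (PVar r)
  then show ?case by (metis fed_fed_arg.PVar id_apply)
next
  case (PMu t)
  have "\<not> scons False S r" for r
    using PMu.prems(1) by (cases r rule: ref_cases) auto
  with PMu show ?case by (blast intro: fed_fed_arg.PMu)
qed (auto intro: fed_fed_arg.intros simp del: id_apply)

text \<open>The two sides need different renamings of \<open>\<lambda>\<close>-references, because a
  \<open>\<lambda>\<close> that has consumed \<open>x\<close> is a binder on the left only. Every
  \<open>\<mu>\<close> is kept on both sides, so a single \<open>\<zeta>\<close> serves
  both.\<close>

lemma fed_pren: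
  "fed x \<rho> S t t' \<Longrightarrow> (\<And>r. \<rho>' (\<xi> r) = \<xi>' (\<rho> r)) \<Longrightarrow> \<xi>' (Free x) = Free x \<Longrightarrow>
    (\<And>r. S' (\<zeta> r) = S r) \<Longrightarrow> fed x \<rho>' S' (pren \<xi> \<zeta> t) (pren \<xi>' \<zeta> t')"
  and fed_arg_pren:
  "fed_arg x \<rho> S t t' \<Longrightarrow> (\<And>r. \<rho>' (\<xi> r) = \<xi>' (\<rho> r)) \<Longrightarrow> \<xi>' (Free x) = Free x \<Longrightarrow>
    (\<And>r. S' (\<zeta> r) = S r) \<Longrightarrow> fed_arg x \<rho>' S' (pren \<xi> \<zeta> t) (pren \<xi>' \<zeta> t')"
proof (induction arbitrary: \<rho>' S' \<xi> \<xi>' \<zeta> and \<rho>' S' \<xi> \<xi>' \<zeta> rule: fed_fed_arg.inducts)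
  case (PVar \<rho> S r)
  then show ?case using fed_fed_arg.PVar[of x \<rho>' S' "\<xi> r"] by simp
next
  case (PLam \<rho> S t t')
  have "lift_ren \<rho>' (lift_ren \<xi> r) = lift_ren \<xi>' (lift_ren \<rho> r)" for r
    using PLam.prems(1) by (cases r rule: ref_cases) auto
  moreover have "lift_ren \<xi>' (Free x) = Free x"
    using PLam.prems(2) lift_ren_simps(2)[of \<xi>' "Free x"] by simp
  ultimately show ?case
    using PLam.prems(3) by (auto intro!: fed_fed_arg.PLam PLam.IH)
next
  case (PMu \<rho> S t t')
  have "scons False S' (lift_ren \<zeta> r) = scons False S r" for r
    using PMu.prems(3) by (cases r rule: ref_cases) auto
  then show ?case
    using PMu.prems by (auto intro!: fed_fed_arg.PMu PMu.IH)
next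
  case (arg_PLam \<rho> S t t')
  have "scons (Free x) \<rho>' (lift_ren \<xi> r) = \<xi>' (scons (Free x) \<rho> r)" for r
    using arg_PLam.prems(1,2) by (cases r rule: ref_cases) auto
  then show ?case
    using arg_PLam.prems by (auto intro!: fed_fed_arg.arg_PLam arg_PLam.IH)
next
  case (arg_PMu \<rho> S t t')
  have "scons True S' (lift_ren \<zeta> r) = scons True S r" for r
    using arg_PMu.prems(3) by (cases r rule: ref_cases) auto
  then show ?case
    using arg_PMu.prems by (auto intro!: fed_fed_arg.arg_PMu arg_PMu.IH)
next
  case (arg_PApp \<rho> S t t')
  then show ?case
    using fed_fed_arg.arg_PApp[of x \<rho>' S' "pren \<xi> \<zeta> t" "pren \<xi>' \<zeta> t'"] by simp
next
  case (PNamed S r \<rho> t t')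
  then show ?case by (auto intro!: fed_fed_arg.PNamed)
qed (auto intro!: fed_fed_arg.intros)

lemma fed_shift_lam:
  "fed x \<rho> S t t' \<Longrightarrow> (\<And>r. \<rho>' (shift r) = \<xi>' (\<rho> r)) \<Longrightarrow> \<xi>' (Free x) = Free x \<Longrightarrow>
    fed x \<rho>' S (shift_lam t) (pren \<xi>' id t')"
  by (rule fed_pren) auto

lemma fed_PApps:
  "list_all2 (fed x \<rho> S) us us' \<Longrightarrow> fed x \<rho> S t t' \<Longrightarrow> fed x \<rho> S (PApps t us) (PApps t' us')"
  by (induction arbitrary: t t' rule: list_all2_induct)
    (auto simp: PApps_Cons intro: fed_fed_arg.PApp)

text \<open>A fed name receives no further arguments: the stages of \<open>(u x)\<close> cannot be followed once the
  result is applied to something else.\<close>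

definition fed_msub where
  "fed_msub x \<rho> S s a a' \<longleftrightarrow> fst a' = fst a \<and> S (fst a) = s \<and>
     list_all2 (fed x \<rho> S) (snd a) (snd a') \<and> (s \<longrightarrow> snd a = [])"

lemma fed_msub_shift_lam:
  assumes "fed_msub x \<rho> S s a a'" "\<And>r. \<rho>' (shift r) = \<xi>' (\<rho> r)" "\<xi>' (Free x) = Free x"
  shows "fed_msub x \<rho>' S s (map_prod id (map shift_lam) a) (map_prod id (map (pren \<xi>' id)) a')"
  using assms
  by (auto simp: fed_msub_def list_all2_map1 list_all2_map2 intro: fed_shift_lam elim!: list_all2_mono)

lemma fed_msub_shift_mu:
  assumes "fed_msub x \<rho> S s a a'"
  shows "fed_msub x \<rho> (scons b S) s (map_prod shift (map shift_mu) a) (map_prod shift (map shift_mu) a')"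
  using assms
  by (auto simp: fed_msub_def list_all2_map1 list_all2_map2 intro: fed_pren elim!: list_all2_mono)

text \<open>Inserted occurrences of \<open>x\<close> have no counterpart in \<open>t\<close>, so
  \<open>f'\<close> has to leave \<open>x\<close> alone. At a \<open>\<lambda>\<close> that has
  consumed \<open>x\<close>, only the left substitution is lifted.\<close>

lemma fed_psub:
  "fed x \<rho> S t t' \<Longrightarrow> (\<And>r. fed x \<rho>' S' (f r) (f' (\<rho> r))) \<Longrightarrow> f' (Free x) = PVar (Free x) \<Longrightarrow>
    (\<And>r. fed_msub x \<rho>' S' (S r) (g r) (g' r)) \<Longrightarrow> fed x \<rho>' S' (psub f g t) (psub f' g' t')"
  and fed_arg_psub:
  "fed_arg x \<rho> S t t' \<Longrightarrow> (\<And>r. fed x \<rho>' S' (f r) (f' (\<rho> r))) \<Longrightarrow> f' (Free x) = PVar (Free x) \<Longrightarrow>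
    (\<And>r. fed_msub x \<rho>' S' (S r) (g r) (g' r)) \<Longrightarrow> fed_arg x \<rho>' S' (psub f g t) (psub f' g' t')"
proof (induction arbitrary: \<rho>' S' f f' g g' and \<rho>' S' f f' g g' rule: fed_fed_arg.inducts)
  case (PLam \<rho> S t t')
  have "fed x (lift_ren \<rho>') S' (lift_sub f r) (lift_sub f' (lift_ren \<rho> r))" for r
  proof (cases r rule: ref_cases)
    case zero
    then show ?thesis using fed_fed_arg.PVar[of x "lift_ren \<rho>'" S' "Bound 0"] by simp
  next
    case (shift s)
    then show ?thesis by (auto intro: fed_shift_lam PLam.prems(1))
  qed
  moreover have "lift_sub f' (Free x) = PVar (Free x)"
    using PLam.prems(2) lift_sub_simps(2)[of f' "Free x"] by simp
  moreover have "fed_msub x (lift_ren \<rho>') S' (S r) (map_prod id (map shift_lam) (g r))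
      (map_prod id (map shift_lam) (g' r))" for r
    by (rule fed_msub_shift_lam[OF PLam.prems(3)]) auto
  ultimately show ?case by (auto intro!: fed_fed_arg.PLam PLam.IH)
next
  case (PMu \<rho> S t t')
  have "fed_msub x \<rho>' (scons False S') (scons False S r) (lift_msub g r) (lift_msub g' r)" for r
  proof (cases r rule: ref_cases)
    case zero
    then show ?thesis by (simp add: fed_msub_def)
  next
    case (shift s)
    then show ?thesis using fed_msub_shift_mu[OF PMu.prems(3)[of s]] by simp
  qed
  moreover have "fed x \<rho>' (scons False S') (shift_mu (f r)) (shift_mu (f' (\<rho> r)))" for r
    by (rule fed_pren[OF PMu.prems(1)]) auto
  ultimately show ?case
    using PMu.prems(2) by (auto intro!: fed_fed_arg.PMu PMu.IH)
next
  case (arg_PMu \<rho> S t t')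
  have "fed_msub x \<rho>' (scons True S') (scons True S r) (lift_msub g r) (lift_msub g' r)" for r
  proof (cases r rule: ref_cases)
    case zero
    then show ?thesis by (simp add: fed_msub_def)
  next
    case (shift s)
    then show ?thesis using fed_msub_shift_mu[OF arg_PMu.prems(3)[of s]] by simp
  qed
  moreover have "fed x \<rho>' (scons True S') (shift_mu (f r)) (shift_mu (f' (\<rho> r)))" for r
    by (rule fed_pren[OF arg_PMu.prems(1)]) auto
  ultimately show ?case
    using arg_PMu.prems(2) by (auto intro!: fed_fed_arg.arg_PMu arg_PMu.IH)
next
  case (arg_PLam \<rho> S t t')
  have "fed x (scons (Free x) \<rho>') S' (lift_sub f r) (f' (scons (Free x) \<rho> r))" for r
  proof (cases r rule: ref_cases)
    case zero
    then show ?thesis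
      using fed_fed_arg.PVar[of x "scons (Free x) \<rho>'" S' "Bound 0"] arg_PLam.prems(2) by simp
  next
    case (shift s)
    then show ?thesis
      using fed_shift_lam[OF arg_PLam.prems(1)[of s], of "scons (Free x) \<rho>'" id] by simp
  qed
  moreover have "fed_msub x (scons (Free x) \<rho>') S' (S r) (map_prod id (map shift_lam) (g r)) (g' r)" for r
    using fed_msub_shift_lam[OF arg_PLam.prems(3)[of r], of "scons (Free x) \<rho>'" id]
    by (simp add: list.map_id0 prod.map_id0 pren_id[abs_def] flip: id_def)
  ultimately show ?case
    using arg_PLam.prems(2) by (auto intro!: fed_fed_arg.arg_PLam arg_PLam.IH)
next
  case (PNamed S r \<rho> t t')
  then have "fed x \<rho>' S' (psub f g t) (psub f' g' t')" by blast
  with PNamed.prems(3)[of r] PNamed.hyps(1) show ?case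
    by (auto simp: fed_msub_def intro!: fed_fed_arg.PNamed fed_PApps)
next
  case (PNamed_arg S r \<rho> t t')
  then have "fed_arg x \<rho>' S' (psub f g t) (psub f' g' t')" by blast
  with PNamed_arg.prems(3)[of r] PNamed_arg.hyps(1) show ?case
    by (auto simp: fed_msub_def intro!: fed_fed_arg.PNamed_arg)
next
  case (arg_PApp \<rho> S t t')
  then have "fed x \<rho>' S' (psub f g t) (psub f' g' t')" by blast
  with arg_PApp.prems(2) show ?case
    by (auto intro: fed_fed_arg.arg_PApp)
qed (auto intro!: fed_fed_arg.intros)

section \<open>Matching the reductions of the stages\<close>

lemma fed_inst_lam:
  assumes "fed x (lift_ren \<rho>) S u u'" "fed x \<rho> S v v'"
  shows "fed x \<rho> S (inst_lam v u) (inst_lam v' u')"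
  unfolding inst_lam_def
proof (rule fed_psub[OF assms(1)])
  show "fed x \<rho> S (scons v PVar r) (scons v' PVar (lift_ren \<rho> r))" for r
    using assms(2) by (cases r rule: ref_cases) (auto intro: fed_fed_arg.PVar)
qed (auto simp: fed_msub_def)

lemma fed_inst_mu:
  assumes "fed x \<rho> (scons False S) u u'" "fed x \<rho> S v v'"
  shows "fed x \<rho> (scons False S) (inst_mu v u) (inst_mu v' u')"
  unfolding inst_mu_def
proof (rule fed_psub[OF assms(1)])
  have "fed x \<rho> (scons False S) (shift_mu v) (shift_mu v')"
    by (rule fed_pren[OF assms(2)]) auto
  then show "fed_msub x \<rho> (scons False S) (scons False S r)
      (scons (Bound 0, [shift_mu v]) (\<lambda>r. (shift r, [])) r)
      (scons (Bound 0, [shift_mu v']) (\<lambda>r. (shift r, [])) r)" for r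
    by (cases r rule: ref_cases) (auto simp: fed_msub_def)
qed (auto intro: fed_fed_arg.PVar)

lemma scons_PVar: "scons (PVar s) PVar = (\<lambda>r. PVar (scons s id r))"
  by (rule scons_eqI) auto

text \<open>Contracting the \<open>\<lambda>\<close> on the right does not move the left side: the
  bound variable of \<open>u\<close> is merely recorded as one that is sent to
  \<open>x\<close>.\<close>

lemma fed_inst_lam_arg:
  assumes "fed x (lift_ren \<rho>) S u u'"
  shows "fed x (scons (Free x) \<rho>) S u (inst_lam (PVar (Free x)) u')"
proof -
  have "inst_lam (PVar (Free x)) u' = pren (scons (Free x) id) id u'"
    using psub_ren[of "scons (Free x) id" id u'] by (simp add: inst_lam_def scons_PVar)
  moreover have "scons (Free x) \<rho> (id r) = scons (Free x) id (lift_ren \<rho> r)" for r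
    by (cases r rule: ref_cases) auto
  then have "fed x (scons (Free x) \<rho>) S (pren id id u) (pren (scons (Free x) id) id u')"
    by (intro fed_pren[OF assms]) auto
  ultimately show ?thesis by simp
qed

text \<open>This is \<open>u[\<alpha> :=* x]\<close> for all \<open>\<alpha>\<close> in
  \<open>N\<close> at once; \<open>N\<close> is a predicate on references so that it extends under
  binders by \<open>scons\<close>.\<close>

definition feed :: "'x \<Rightarrow> ('m ref \<Rightarrow> bool) \<Rightarrow> ('x, 'm) ptrm \<Rightarrow> ('x, 'm) ptrm" where
  "feed x N = psub PVar (\<lambda>r. (r, if N r then [PVar (Free x)] else []))"

lemma map_prod_single_arg:
  "map_prod id (map shift_lam) \<circ> (\<lambda>r. (r, if N r then [PVar (Free x)] else [])) =
   (\<lambda>r. (r, if N r then [PVar (Free x)] else []))"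
  by auto

lemma lift_msub_single_arg:
  "lift_msub (\<lambda>r. (r, if N r then [PVar (Free x)] else [])) =
   (\<lambda>r. (r, if scons False N r then [PVar (Free x)] else []))"
  unfolding lift_msub_def by (rule scons_eqI) auto

lemma feed_simps:
  "feed x N (PVar s) = PVar s"
  "feed x N (PLam t) = PLam (feed x N t)"
  "feed x N (PApp t u) = PApp (feed x N t) (feed x N u)"
  "feed x N (PMu t) = PMu (feed x (scons False N) t)"
  "feed x N (PNamed r t) =
     PNamed r (if N r then PApp (feed x N t) (PVar (Free x)) else feed x N t)"
  by (auto simp: feed_def PApps_def map_prod_single_arg lift_msub_single_arg lift_sub_id
      pren_comp_PVar simp del: comp_apply)

text \<open>Below a name not yet fed the two subterms are related by \<open>fed\<close>, so applying
  the right one to \<open>x\<close> produces an initial stage, and the name becomes fed.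
  Disjointness of \<open>S\<close> and \<open>N\<close> prevents a second \<open>x\<close> from
  being applied.\<close>

lemma fed_feed:
  "fed x \<rho> S t t' \<Longrightarrow> (\<And>r. \<not> (S r \<and> N r)) \<Longrightarrow> (\<And>r. S' r \<longleftrightarrow> S r \<or> N r) \<Longrightarrow>
    fed x \<rho> S' t (feed x N t')"
  and fed_arg_feed:
  "fed_arg x \<rho> S t t' \<Longrightarrow> (\<And>r. \<not> (S r \<and> N r)) \<Longrightarrow> (\<And>r. S' r \<longleftrightarrow> S r \<or> N r) \<Longrightarrow>
    fed_arg x \<rho> S' t (feed x N t')"
proof (induction arbitrary: S' N and S' N rule: fed_fed_arg.inducts)
  case (PMu \<rho> S t t')
  have "\<not> (scons False S r \<and> scons False N r)"
    "scons False S' r \<longleftrightarrow> scons False S r \<or> scons False N r" for r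
    using PMu.prems by (cases r rule: ref_cases; auto)+
  then have "fed x \<rho> (scons False S') t (feed x (scons False N) t')"
    by (rule PMu.IH(2))
  then show ?case by (simp add: feed_simps fed_fed_arg.PMu)
next
  case (arg_PMu \<rho> S t t')
  have "\<not> (scons True S r \<and> scons False N r)"
    "scons True S' r \<longleftrightarrow> scons True S r \<or> scons False N r" for r
    using arg_PMu.prems by (cases r rule: ref_cases; auto)+
  then have "fed x \<rho> (scons True S') t (feed x (scons False N) t')"
    by (rule arg_PMu.IH(2))
  then show ?case by (simp add: feed_simps fed_fed_arg.arg_PMu)
next
  case (PNamed S r \<rho> t t')
  then have "fed x \<rho> S' t (feed x N t')" by blast
  with PNamed show ?case
    by (auto simp: feed_simps intro: fed_fed_arg.PNamed fed_fed_arg.PNamed_arg fed_fed_arg.arg_PApp)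
next
  case (PNamed_arg S r \<rho> t t')
  then have "fed_arg x \<rho> S' t (feed x N t')" by blast
  with PNamed_arg show ?case
    by (auto simp: feed_simps intro: fed_fed_arg.PNamed_arg)
qed (auto simp: feed_simps intro: fed_fed_arg.intros)

lemma scons_single_arg: "scons (Bound 0, [w]) (\<lambda>r. (shift r, [])) =
    (\<lambda>r. (r, if scons True (\<lambda>_. False) r then [w] else []))"
  by (rule scons_eqI) auto

lemma inst_mu_Free: "inst_mu (PVar (Free x)) t = feed x (scons True (\<lambda>_. False)) t"
  by (simp add: inst_mu_def feed_def scons_single_arg)

lemma fed_inst_mu_arg:
  assumes "fed x \<rho> (scons False S) u u'"
  shows "fed x \<rho> (scons True S) u (inst_mu (PVar (Free x)) u')"
proof -
  let ?N = "scons True (\<lambda>_. False)"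
  have "\<not> (scons False S r \<and> ?N r)" "scons True S r \<longleftrightarrow> scons False S r \<or> ?N r" for r
    by (cases r rule: ref_cases; auto)+
  then have "fed x \<rho> (scons True S) u (feed x ?N u')"
    by (intro fed_feed[OF assms]) auto
  then show ?thesis by (simp add: inst_mu_Free)
qed

inductive_cases pstep_PVarE: "pstep (PVar r) w"
inductive_cases pstep_PLamE: "pstep (PLam t) w"
inductive_cases pstep_PAppE: "pstep (PApp t u) w"
inductive_cases pstep_PMuE: "pstep (PMu t) w"
inductive_cases pstep_PNamedE: "pstep (PNamed r t) w"

text \<open>\<open>fed\<close> preserves the outermost constructor, and a stage of
  \<open>fed_arg\<close> never stands in function position. Hence a redex of \<open>t'\<close>
  either comes from a redex of \<open>t\<close> or has an inserted \<open>x\<close> as its argument.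
  A step of the second kind turns one stage into the next while \<open>t\<close> stays put, whence
  the reflexive closure.\<close>

lemma fed_pstep: "fed x \<rho> S t t' \<Longrightarrow> pstep t' w \<Longrightarrow> \<exists>v. pstep\<^sup>=\<^sup>= t v \<and> fed x \<rho> S v w"
  and fed_arg_pstep: "fed_arg x \<rho> S t t' \<Longrightarrow> pstep t' w \<Longrightarrow> \<exists>v. pstep\<^sup>=\<^sup>= t v \<and> fed_arg x \<rho> S v w"
proof (induction arbitrary: w and w rule: fed_fed_arg.inducts)
  case (PVar \<rho> S r)
  then show ?case by (auto elim: pstep_PVarE)
next
  case (PLam \<rho> S t t')
  from PLam.prems obtain w' where "w = PLam w'" "pstep t' w'" by (auto elim: pstep_PLamE)
  with PLam.IH show ?case by (blast intro: fed_fed_arg.PLam pstep.lam_cong)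
next
  case (PApp \<rho> S t t' u u')
  from PApp.prems consider
      (beta) s where "t' = PLam s" "w = inst_lam u' s"
    | (mu) s where "t' = PMu s" "w = PMu (inst_mu u' s)"
    | (cong1) s where "w = PApp s u'" "pstep t' s"
    | (cong2) s where "w = PApp t' s" "pstep u' s"
    by (auto elim: pstep_PAppE)
  then show ?case
  proof cases
    case (beta s)
    with PApp.IH(1) obtain s0 where "t = PLam s0" "fed x (lift_ren \<rho>) S s0 s"
      by (auto elim: fed_PLamE)
    with beta PApp.IH(3) show ?thesis
      by (blast intro: pstep.beta fed_inst_lam)
  next
    case (mu s)
    with PApp.IH(1) obtain s0 where "t = PMu s0" "fed x \<rho> (scons False S) s0 s"
      by (auto elim: fed_PMuE)
    with mu PApp.IH(3) show ?thesis
      by (blast intro: pstep.mu fed_inst_mu fed_fed_arg.PMu)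
  next
    case (cong1 s)
    with PApp.IH(2) PApp.IH(3) show ?thesis by (blast intro: fed_fed_arg.PApp pstep.app_cong1)
  next
    case (cong2 s)
    with PApp.IH(4) PApp.IH(1) show ?thesis by (blast intro: fed_fed_arg.PApp pstep.app_cong2)
  qed
next
  case (PMu \<rho> S t t')
  from PMu.prems obtain w' where "w = PMu w'" "pstep t' w'" by (auto elim: pstep_PMuE)
  with PMu.IH show ?case by (blast intro: fed_fed_arg.PMu pstep.mu_cong)
next
  case (PNamed S r \<rho> t t')
  from PNamed.prems obtain w' where "w = PNamed r w'" "pstep t' w'" by (auto elim: pstep_PNamedE)
  with PNamed.IH PNamed.hyps(1) show ?case by (blast intro: fed_fed_arg.PNamed pstep.named_cong)
next
  case (PNamed_arg S r \<rho> t t')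
  from PNamed_arg.prems obtain w' where "w = PNamed r w'" "pstep t' w'" by (auto elim: pstep_PNamedE)
  with PNamed_arg.IH PNamed_arg.hyps(1) show ?case
      by (blast intro: fed_fed_arg.PNamed_arg pstep.named_cong)
next
  case (arg_PApp \<rho> S t t')
  from arg_PApp.prems consider
      (beta) s where "t' = PLam s" "w = inst_lam (PVar (Free x)) s"
    | (mu) s where "t' = PMu s" "w = PMu (inst_mu (PVar (Free x)) s)"
    | (cong1) s where "w = PApp s (PVar (Free x))" "pstep t' s"
    | (cong2) s where "w = PApp t' s" "pstep (PVar (Free x)) s"
    by (auto elim: pstep_PAppE)
  then show ?case
  proof cases
    case (beta s)
    with arg_PApp.IH(1) obtain s0 where "t = PLam s0" "fed x (lift_ren \<rho>) S s0 s"
      by (auto elim: fed_PLamE)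
    with beta show ?thesis
      by (blast intro: fed_inst_lam_arg fed_fed_arg.arg_PLam)
  next
    case (mu s)
    with arg_PApp.IH(1) obtain s0 where "t = PMu s0" "fed x \<rho> (scons False S) s0 s"
      by (auto elim: fed_PMuE)
    with mu show ?thesis
      by (blast intro: fed_inst_mu_arg fed_fed_arg.arg_PMu)
  next
    case (cong1 s)
    with arg_PApp.IH show ?thesis by (blast intro: fed_fed_arg.arg_PApp)
  next
    case (cong2 s)
    then show ?thesis by (auto elim: pstep_PVarE)
  qed
next
  case (arg_PLam \<rho> S t t')
  then show ?case by (blast intro: fed_fed_arg.arg_PLam pstep.lam_cong)
next
  case (arg_PMu \<rho> S t t')
  from arg_PMu.prems obtain w' where "w = PMu w'" "pstep t' w'" by (auto elim: pstep_PMuE)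
  with arg_PMu.IH show ?case by (blast intro: fed_fed_arg.arg_PMu pstep.mu_cong)
qed

lemma fed_arg_psteps:
  "pstep\<^sup>*\<^sup>* t' w \<Longrightarrow> fed_arg x \<rho> S t t' \<Longrightarrow> \<exists>v. pstep\<^sup>*\<^sup>* t v \<and> fed_arg x \<rho> S v w"
proof (induction rule: rtranclp_induct)
  case (step w w')
  then obtain v where v: "pstep\<^sup>*\<^sup>* t v" "fed_arg x \<rho> S v w" by blast
  from fed_arg_pstep[OF v(2) step.hyps(2)] obtain v' where "pstep\<^sup>=\<^sup>= v v'" "fed_arg x \<rho> S v' w'"
    by blast
  with v(1) show ?case by (auto intro: rtranclp.rtrancl_into_rtrancl)
qed blast

section \<open>Types of the stages\<close>

definition unfed_type :: "'p ty \<Rightarrow> bool \<Rightarrow> 'p ty option \<Rightarrow> 'p ty option" where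
  "unfed_type A s = (if s then map_option ((\<rightarrow>) A) else id)"

text \<open>Below a fed name the subterm \<open>u\<close> has been replaced by a stage of
  \<open>(u x)\<close>, so a name of type \<open>B\<close> on the right has type
  \<open>A \<rightarrow> B\<close> on the left. With this correction, and with \<open>\<rho>\<close>
  pulling the declarations back, the rules of \<open>fed\<close> follow the typing rules.\<close>

lemma fed_ptyping:
  "fed x \<rho> S t t' \<Longrightarrow> ptyping \<Gamma>' \<Delta>' t' B \<Longrightarrow> \<Gamma>' (Free x) = Some A \<Longrightarrow>
    (\<And>r. \<Gamma> r = \<Gamma>' (\<rho> r)) \<Longrightarrow> (\<And>r. \<Delta> r = unfed_type A (S r) (\<Delta>' r)) \<Longrightarrow> ptyping \<Gamma> \<Delta> t B"
  and fed_arg_ptyping: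
  "fed_arg x \<rho> S t t' \<Longrightarrow> ptyping \<Gamma>' \<Delta>' t' B \<Longrightarrow> \<Gamma>' (Free x) = Some A \<Longrightarrow>
    (\<And>r. \<Gamma> r = \<Gamma>' (\<rho> r)) \<Longrightarrow> (\<And>r. \<Delta> r = unfed_type A (S r) (\<Delta>' r)) \<Longrightarrow>
    ptyping \<Gamma> \<Delta> t (A \<rightarrow> B)"
proof (induction arbitrary: \<Gamma> \<Gamma>' \<Delta> \<Delta>' B and \<Gamma> \<Gamma>' \<Delta> \<Delta>' B rule: fed_fed_arg.inducts)
  case (PVar \<rho> S r)
  then show ?case by (auto elim!: ptyping_PVarE intro: ptyping.ax)
next
  case (PLam \<rho> S t t')
  from PLam.prems(1) obtain C D where B: "B = C \<rightarrow> D" "ptyping (scons (Some C) \<Gamma>') \<Delta>' t' D"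
    by (auto elim: ptyping_PLamE)
  have "ptyping (scons (Some C) \<Gamma>) \<Delta> t D"
  proof (rule PLam.IH(2)[OF B(2)])
    show "scons (Some C) \<Gamma>' (Free x) = Some A" using PLam.prems(2) by simp
    show "scons (Some C) \<Gamma> r = scons (Some C) \<Gamma>' (lift_ren \<rho> r)" for r
      using PLam.prems(3) by (cases r rule: ref_cases) auto
  qed (use PLam.prems in auto)
  with B show ?case by (auto intro: ptyping.fun_i)
next
  case (PApp \<rho> S t t' u u')
  from PApp.prems(1) obtain C where C: "ptyping \<Gamma>' \<Delta>' t' (C \<rightarrow> B)" "ptyping \<Gamma>' \<Delta>' u' C"
    by (auto elim: ptyping_PAppE)
  show ?case
    by (rule ptyping.fun_e[OF PApp.IH(2)[OF C(1)] PApp.IH(4)[OF C(2)]]) (use PApp.prems in auto)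
next
  case (PMu \<rho> S t t')
  from PMu.prems(1) have t': "ptyping \<Gamma>' (scons (Some B) \<Delta>') t' Bot"
    by (auto elim: ptyping_PMuE)
  have "ptyping \<Gamma> (scons (Some B) \<Delta>) t Bot"
  proof (rule PMu.IH(2)[OF t'])
    show "scons (Some B) \<Delta> r = unfed_type A (scons False S r) (scons (Some B) \<Delta>' r)" for r
      using PMu.prems(4) by (cases r rule: ref_cases) (auto simp: unfed_type_def)
  qed (use PMu.prems in auto)
  then show ?case by (rule ptyping.mu)
next
  case (PNamed S r \<rho> t t')
  from PNamed.prems(1) obtain C where C: "B = Bot" "\<Delta>' r = Some C" "ptyping \<Gamma>' \<Delta>' t' C"
    by (auto elim: ptyping_PNamedE)
  have "ptyping \<Gamma> \<Delta> t C" by (rule PNamed.IH(2)[OF C(3)]) (use PNamed.prems in auto)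
  moreover have "\<Delta> r = Some C" using PNamed C by (simp add: unfed_type_def)
  ultimately show ?case using C by (auto intro: ptyping.bot)
next
  case (PNamed_arg S r \<rho> t t')
  from PNamed_arg.prems(1) obtain C where C: "B = Bot" "\<Delta>' r = Some C" "ptyping \<Gamma>' \<Delta>' t' C"
    by (auto elim: ptyping_PNamedE)
  have "ptyping \<Gamma> \<Delta> t (A \<rightarrow> C)" by (rule PNamed_arg.IH(2)[OF C(3)]) (use PNamed_arg.prems in auto)
  moreover have "\<Delta> r = Some (A \<rightarrow> C)" using PNamed_arg C by (simp add: unfed_type_def)
  ultimately show ?case using C by (auto intro: ptyping.bot)
next
  case (arg_PApp \<rho> S t t')
  from arg_PApp.prems(1,2) have t': "ptyping \<Gamma>' \<Delta>' t' (A \<rightarrow> B)"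
    by (auto elim!: ptyping_PAppE ptyping_PVarE)
  show ?case by (rule arg_PApp.IH(2)[OF t']) (use arg_PApp.prems in auto)
next
  case (arg_PLam \<rho> S t t')
  have "ptyping (scons (Some A) \<Gamma>) \<Delta> t B"
  proof (rule arg_PLam.IH(2)[OF arg_PLam.prems(1)])
    show "scons (Some A) \<Gamma> r = \<Gamma>' (scons (Free x) \<rho> r)" for r
      using arg_PLam.prems(2,3) by (cases r rule: ref_cases) auto
  qed (use arg_PLam.prems in auto)
  then show ?case by (rule ptyping.fun_i)
next
  case (arg_PMu \<rho> S t t')
  from arg_PMu.prems(1) have t': "ptyping \<Gamma>' (scons (Some B) \<Delta>') t' Bot"
    by (auto elim: ptyping_PMuE)
  have "ptyping \<Gamma> (scons (Some (A \<rightarrow> B)) \<Delta>) t Bot"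
  proof (rule arg_PMu.IH(2)[OF t'])
    show "scons (Some (A \<rightarrow> B)) \<Delta> r = unfed_type A (scons True S r) (scons (Some B) \<Delta>' r)" for r
      using arg_PMu.prems(4) by (cases r rule: ref_cases) (auto simp: unfed_type_def)
  qed (use arg_PMu.prems in auto)
  then show ?case by (rule ptyping.mu)
qed

text \<open>The initial stage is \<open>(t x)\<close> itself, with no name fed and
  \<open>\<rho>\<close> the identity. Occurrences of \<open>x\<close> in \<open>t\<close> are
  related to themselves and thus kept apart from the inserted ones.\<close>

lemma psteps_PApp_Free_typed:
  assumes "pstep\<^sup>*\<^sup>* (PApp t (PVar (Free x))) w" "ptyping \<Gamma> \<Delta> w B" "\<Gamma> (Free x) = Some A"
  shows "\<exists>v. pstep\<^sup>*\<^sup>* t v \<and> ptyping \<Gamma> \<Delta> v (A \<rightarrow> B)"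
proof -
  have "fed_arg x id (\<lambda>_. False) t (PApp t (PVar (Free x)))"
    by (intro fed_fed_arg.arg_PApp fed_refl) auto
  from fed_arg_psteps[OF assms(1) this] obtain v
    where "pstep\<^sup>*\<^sup>* t v" "fed_arg x id (\<lambda>_. False) v w" by blast
  moreover from fed_arg_ptyping[OF this(2) assms(2,3)] have "ptyping \<Gamma> \<Delta> v (A \<rightarrow> B)"
    by (simp add: unfed_type_def)
  ultimately show ?thesis by blast
qed

section \<open>Completeness\<close>

lemma pfv_psubst: "pfv (psubst x v t) \<subseteq> (pfv t - {x}) \<union> pfv v"
proof (induction t)
  case (PVar r)
  then show ?case by (cases r) auto
qed auto

lemma pfmv_psubst: "pfmv (psubst x v t) \<subseteq> pfmv t \<union> pfmv v"
  by (induction t) auto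

lemma pfv_pmsubst: "pfv (pmsubst \<alpha> v t) \<subseteq> pfv t \<union> pfv v"
  by (induction t) auto

lemma pfmv_pmsubst: "pfmv (pmsubst \<alpha> v t) \<subseteq> pfmv t \<union> pfmv v"
  by (induction t) auto

lemma red_free_names: "t \<triangleright> t' \<Longrightarrow> fv t' \<subseteq> fv t \<and> fmv t' \<subseteq> fmv t"
proof (induction rule: red.induct)
  case (beta x u v)
  show ?case
    using pfv_psubst[of x "Rep_trm v" "Rep_trm u"] pfmv_psubst[of x "Rep_trm v" "Rep_trm u"]
    by (auto simp: fv_simps fmv_simps) (auto simp: fv.rep_eq fmv.rep_eq subst.rep_eq)
next
  case (mu \<alpha> v u)
  show ?case
    using pfv_pmsubst[of \<alpha> "Rep_trm v" "Rep_trm u"] pfmv_pmsubst[of \<alpha> "Rep_trm v" "Rep_trm u"]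
    by (auto simp: fv_simps fmv_simps) (auto simp: fv.rep_eq fmv.rep_eq msubst.rep_eq)
qed (auto simp: fv_simps fmv_simps)

lemma reds_free_names: "t \<triangleright>\<^sup>* t' \<Longrightarrow> fv t' \<subseteq> fv t \<and> fmv t' \<subseteq> fmv t"
  by (induction rule: rtranclp_induct) (auto dest!: red_free_names)

lemma ptyping_free_names:
  "ptyping \<Gamma> \<Delta> t A \<Longrightarrow> pfv t \<subseteq> {x. \<Gamma> (Free x) \<noteq> None} \<and> pfmv t \<subseteq> {\<alpha>. \<Delta> (Free \<alpha>) \<noteq> None}"
proof (induction rule: ptyping.induct)
  case (ax \<Gamma> r A \<Delta>)
  then show ?case by (cases r) auto
next
  case (bot \<Delta> r A \<Gamma> t)
  then show ?case by (cases r) auto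
qed auto

section \<open>The term model\<close>

definition typable ::
    "('x ref \<Rightarrow> 'p ty option) \<Rightarrow> ('m ref \<Rightarrow> 'p ty option) \<Rightarrow> 'p ty \<Rightarrow> ('x, 'm) trm set" where
  "typable \<Gamma> \<Delta> A = {t. \<exists>t'. t \<triangleright>\<^sup>* t' \<and> ptyping \<Gamma> \<Delta> (Rep_trm t') A}"

lemma saturated_typable: "saturated (typable \<Gamma> \<Delta> A)"
  unfolding saturated_def typable_def by (blast intro: rtranclp_trans)

lemma Var_in_typable: "\<Gamma> (Free x) = Some A \<Longrightarrow> Var x \<in> typable \<Gamma> \<Delta> A"
  by (auto simp: typable_def Var.rep_eq intro!: exI[of _ "Var x"] ptyping.ax)

lemma reds_Mu: "t \<triangleright>\<^sup>* t' \<Longrightarrow> Mu \<alpha> t \<triangleright>\<^sup>* Mu \<alpha> t'"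
  by (induction rule: rtranclp_induct) (auto intro: red.mu_cong rtranclp.rtrancl_into_rtrancl)

lemma reds_Named: "t \<triangleright>\<^sup>* t' \<Longrightarrow> Named \<alpha> t \<triangleright>\<^sup>* Named \<alpha> t'"
  by (induction rule: rtranclp_induct) (auto intro: red.named_cong rtranclp.rtrancl_into_rtrancl)

text \<open>The context declares \<open>\<alpha>\<close> in advance, and binding
  \<open>\<alpha>\<close> hands its declaration over to index 0. The type of the abstraction is thus
  dictated by the name that is bound, as the conditions on the \<open>C_fam M i\<close>
  demand.\<close>

lemma Mu_in_typable:
  assumes "\<Delta> (Free \<alpha>) = Some A" "t \<in> typable \<Gamma> \<Delta> Bot"
  shows "Mu \<alpha> t \<in> typable \<Gamma> \<Delta> A"
proof -
  from assms(2) obtain t' where t': "t \<triangleright>\<^sup>* t'" "ptyping \<Gamma> \<Delta> (Rep_trm t') Bot"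
    by (auto simp: typable_def)
  have "ptyping \<Gamma> (scons (Some A) \<Delta>) (pren id (bind0 \<alpha>) (Rep_trm t')) Bot"
    by (rule ptyping_pren[OF t'(2)]) (use assms(1) in \<open>auto simp: bind0_def\<close>)
  then have "ptyping \<Gamma> \<Delta> (Rep_trm (Mu \<alpha> t')) A"
    by (simp add: Mu.rep_eq pmbind0 ptyping.mu)
  with reds_Mu[OF t'(1)] show ?thesis by (auto simp: typable_def)
qed

lemma Named_in_typable:
  assumes "\<Delta> (Free \<alpha>) = Some A" "t \<in> typable \<Gamma> \<Delta> A"
  shows "Named \<alpha> t \<in> typable \<Gamma> \<Delta> Bot"
proof -
  from assms(2) obtain t' where t': "t \<triangleright>\<^sup>* t'" "ptyping \<Gamma> \<Delta> (Rep_trm t') A"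
    by (auto simp: typable_def)
  have "ptyping \<Gamma> \<Delta> (Rep_trm (Named \<alpha> t')) Bot"
    using assms(1) t'(2) by (simp add: Named.rep_eq ptyping.bot)
  with reds_Named[OF t'(1)] show ?thesis by (auto simp: typable_def)
qed

text \<open>From right to left a single test suffices: \<open>Var x\<close> lies in
  \<open>typable \<Gamma> \<Delta> A\<close>, and a typed reduct of \<open>(t x)\<close> gives a
  typed reduct of \<open>t\<close>.\<close>

lemma typable_Fun:
  fixes \<Gamma> :: "('x :: infinite) ref \<Rightarrow> 'p ty option" and \<Delta> :: "('m :: infinite) ref \<Rightarrow> 'p ty option"
  assumes x: "\<Gamma> (Free x) = Some A"
  shows "typable \<Gamma> \<Delta> (A \<rightarrow> B) = (typable \<Gamma> \<Delta> A \<leadsto> typable \<Gamma> \<Delta> B)"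
proof (intro equalityI subsetI)
  fix t assume "t \<in> typable \<Gamma> \<Delta> (A \<rightarrow> B)"
  then obtain t' where t': "t \<triangleright>\<^sup>* t'" "ptyping \<Gamma> \<Delta> (Rep_trm t') (A \<rightarrow> B)"
    by (auto simp: typable_def)
  have "App t u \<in> typable \<Gamma> \<Delta> B" if "u \<in> typable \<Gamma> \<Delta> A" for u
  proof -
    from that obtain u' where u': "u \<triangleright>\<^sup>* u'" "ptyping \<Gamma> \<Delta> (Rep_trm u') A"
      by (auto simp: typable_def)
    have "App t u \<triangleright>\<^sup>* App t' u'"
      using reds_App_fun[OF t'(1)] reds_App_arg[OF u'(1)] by (rule rtranclp_trans)
    moreover have "ptyping \<Gamma> \<Delta> (Rep_trm (App t' u')) B"
      using t'(2) u'(2) by (auto simp: App.rep_eq intro: ptyping.fun_e)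
    ultimately show ?thesis by (auto simp: typable_def)
  qed
  then show "t \<in> typable \<Gamma> \<Delta> A \<leadsto> typable \<Gamma> \<Delta> B" by (simp add: arrow_def)
next
  fix t assume "t \<in> typable \<Gamma> \<Delta> A \<leadsto> typable \<Gamma> \<Delta> B"
  then have "App t (Var x) \<in> typable \<Gamma> \<Delta> B"
    using Var_in_typable[of \<Gamma> x A \<Delta>, OF x] by (simp add: arrow_def)
  then obtain w where w: "App t (Var x) \<triangleright>\<^sup>* w" "ptyping \<Gamma> \<Delta> (Rep_trm w) B"
    by (auto simp: typable_def)
  have "pstep\<^sup>*\<^sup>* (PApp (Rep_trm t) (PVar (Free x))) (Rep_trm w)"
    using reds_imp_psteps[OF w(1)] by (simp add: App.rep_eq Var.rep_eq)
  from psteps_PApp_Free_typed[OF this w(2) x] obtain v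
    where v: "pstep\<^sup>*\<^sup>* (Rep_trm t) v" "ptyping \<Gamma> \<Delta> v (A \<rightarrow> B)" by blast
  from psteps_imp_reds[OF v(1)] have "t \<triangleright>\<^sup>* Abs_trm v" "scoped 0 0 v"
    by (auto simp: Rep_trm_inverse)
  with v(2) show "t \<in> typable \<Gamma> \<Delta> (A \<rightarrow> B)"
    by (auto simp: typable_def Abs_trm_inverse intro!: exI[of _ "Abs_trm v"])
qed

primrec subtypes :: "'p ty \<Rightarrow> 'p ty list" where
  "subtypes (TVar X) = [TVar X]"
| "subtypes Bot = [Bot]"
| "subtypes (A \<rightarrow> B) = (A \<rightarrow> B) # subtypes A @ subtypes B"

lemma self_in_subtypes: "A \<in> set (subtypes A)"
  by (cases A) auto

text \<open>The leading \<open>Bot\<close> makes index 0 interpret \<open>Bot\<close>, as in every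
  model. Indices beyond the list default to \<open>Bot\<close>, so that every natural number can
  serve as an index.\<close>

definition nth_type :: "'p ty \<Rightarrow> nat \<Rightarrow> 'p ty" where
  "nth_type A i = (let As = Bot # subtypes A in if i < length As then As ! i else Bot)"

lemma nth_type_0 [simp]: "nth_type A 0 = Bot"
  by (simp add: nth_type_def)

lemma ex_nth_type: "B \<in> set (subtypes A) \<Longrightarrow> \<exists>i. nth_type A i = B"
proof -
  assume "B \<in> set (subtypes A)"
  then obtain i where "i < length (subtypes A)" "subtypes A ! i = B" by (auto simp: in_set_conv_nth)
  then show ?thesis by (intro exI[of _ "Suc i"]) (simp add: nth_type_def)
qed

definition decl :: "(nat \<Rightarrow> 'v) \<Rightarrow> (nat \<Rightarrow> 'p ty) \<Rightarrow> 'v ref \<Rightarrow> 'p ty option" where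
  "decl \<phi> T = ctx_of (\<lambda>x. if x \<in> range \<phi> then Some (T (inv \<phi> x)) else None)"

lemma decl_Free: "inj \<phi> \<Longrightarrow> decl \<phi> T (Free (\<phi> n)) = Some (T n)"
  by (simp add: decl_def)

lemma decl_dom: "{x. decl \<phi> T (Free x) \<noteq> None} = range \<phi>"
  by (auto simp: decl_def)

text \<open>One \<open>\<lambda>\<close>-variable for each subformula of \<open>A\<close> suffices, but the \<open>\<C>\<^sub>i\<close> must be infinite; both kinds
  of declared variables avoid the free variables of the given term, so that a typable reduct is
  closed.\<close>

lemma sem_imp_typable:
  fixes t :: "('x :: infinite, 'm :: infinite) trm" and A :: "'p ty"
  assumes "t \<in> sem A" and \<phi>: "inj (\<phi> :: nat \<Rightarrow> 'x)" and \<psi>: "inj (\<psi> :: nat \<Rightarrow> 'm)"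
  shows "t \<in> typable (decl \<phi> (nth_type A)) (decl \<psi> (nth_type A \<circ> fst \<circ> prod_decode)) A"
proof -
  define W :: "'p ty \<Rightarrow> ('x, 'm) trm set" where
    "W = typable (decl \<phi> (nth_type A)) (decl \<psi> (nth_type A \<circ> fst \<circ> prod_decode))"
  \<comment> \<open>\<open>prod_encode\<close> splits the declared \<open>\<mu>\<close>-variables
    into disjoint infinite sets, those of index \<open>i\<close> having type
    \<open>nth_type A i\<close>. The arrows occurring in \<open>A\<close> are again base sets by
    \<open>typable_Fun\<close>, so \<open>J_idx\<close> may be empty.\<close>
  define M :: "('x, 'm) model" where
    "M = \<lparr>I_idx = UNIV, J_idx = {}, C_fam = (\<lambda>i. range (\<lambda>n. \<psi> (prod_encode (i, n)))),
      B_fam = (\<lambda>i. W (nth_type A i)), R_fam = (\<lambda>_. {})\<rparr>"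
  have M_sel: "I_idx M = UNIV" "J_idx M = {}" "B_fam M i = W (nth_type A i)"
    "C_fam M i = range (\<lambda>n. \<psi> (prod_encode (i, n)))" for i
    by (simp_all add: M_def)
  have decl_\<phi>: "decl \<phi> (nth_type A) (Free (\<phi> i)) = Some (nth_type A i)" for i
    using \<phi> by (rule decl_Free)
  have decl_\<psi>: "decl \<psi> (nth_type A \<circ> fst \<circ> prod_decode) (Free \<alpha>) = Some (nth_type A i)"
    if "\<alpha> \<in> C_fam M i" for \<alpha> i
    using that by (auto simp: M_sel decl_Free[OF \<psi>])
  have "is_model M"
    unfolding is_model_def
  proof (intro conjI ballI)
    show "infinite (C_fam M i)" for i
      unfolding M_sel by (subst finite_image_iff) (auto intro!: injI dest!: injD[OF \<psi>])
    show "disjoint_family_on (C_fam M) (I_idx M)"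
      by (auto simp: disjoint_family_on_def M_sel dest!: injD[OF \<psi>])
    show "B_fam M i \<noteq> {}" for i
    proof -
      have "Var (\<phi> i) \<in> W (nth_type A i)"
        unfolding W_def by (rule Var_in_typable) (rule decl_\<phi>)
      then show ?thesis by (auto simp: M_sel)
    qed
    show "saturated (B_fam M i)" for i
      by (simp add: M_sel W_def saturated_typable)
    show "Mu \<alpha> u \<in> B_fam M i" if "\<alpha> \<in> C_fam M i" "u \<in> B_fam M 0" for i \<alpha> u
      using that(2) unfolding M_sel W_def nth_type_0
      by (rule Mu_in_typable[where A = "nth_type A i", rotated]) (rule decl_\<psi>[OF that(1)])
    show "Named \<alpha> u \<in> B_fam M 0" if "\<alpha> \<in> C_fam M i" "u \<in> B_fam M i" for i \<alpha> u
      using that(2) unfolding M_sel W_def nth_type_0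
      by (rule Named_in_typable[where A = "nth_type A i", rotated]) (rule decl_\<psi>[OF that(1)])
  qed (auto simp: M_sel)
  \<comment> \<open>Propositional variables foreign to \<open>A\<close> only have to stay in the
    universe; \<open>W Bot\<close> is the base set of index 0.\<close>
  define \<I> where "\<I> X = (if TVar X \<in> set (subtypes A) then W (TVar X) else W Bot)" for X
  have W_universe: "W B \<in> universe M" if "\<exists>i. nth_type A i = B" for B
    using that universe.B[of _ M] by (auto simp: M_sel)
  have "is_interp M \<I>"
    unfolding is_interp_def \<I>_def using W_universe ex_nth_type nth_type_0 by metis
  \<comment> \<open>The restriction to subformulas of \<open>A\<close> guarantees a variable
    declared with the type on the left of each arrow, as \<open>typable_Fun\<close> demands.\<close>
  have "interp M \<I> B = W B" if "set (subtypes B) \<subseteq> set (subtypes A)" for B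
    using that
  proof (induction B)
    case (Fun B C)
    then obtain i where "nth_type A i = B"
      using ex_nth_type[of B A] self_in_subtypes[of B] by auto
    then have "W (B \<rightarrow> C) = (W B \<leadsto> W C)"
      unfolding W_def using decl_\<phi>[of i] by (intro typable_Fun) simp
    with Fun show ?case by simp
  qed (auto simp: \<I>_def M_sel)
  then have "interp M \<I> A = W A" by simp
  with assms(1) \<open>is_model M\<close> \<open>is_interp M \<I>\<close> show ?thesis
    by (auto simp: sem_def sem_in_def W_def)
qed

lemma sem_imp_typing:
  fixes t :: "('x :: infinite, 'm :: infinite) trm" and A :: "'p ty"
  assumes "t \<in> sem A"
  shows "\<exists>t'. closed_trm t' \<and> t \<triangleright>\<^sup>* t' \<and> (Map.empty \<turnstile> t' : A ; Map.empty)"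
proof -
  obtain \<phi> :: "nat \<Rightarrow> 'x" where \<phi>: "inj \<phi>" "range \<phi> \<subseteq> - fv t"
    using infinite_countable_subset[of "- fv t"] finite_fv[of t]
    by (metis Diff_infinite_finite Compl_eq_Diff_UNIV infinite_UNIV)
  obtain \<psi> :: "nat \<Rightarrow> 'm" where \<psi>: "inj \<psi>" "range \<psi> \<subseteq> - fmv t"
    using infinite_countable_subset[of "- fmv t"] finite_fmv[of t]
    by (metis Diff_infinite_finite Compl_eq_Diff_UNIV infinite_UNIV)
  from sem_imp_typable[OF assms \<phi>(1) \<psi>(1)] obtain t' where t': "t \<triangleright>\<^sup>* t'"
    "ptyping (decl \<phi> (nth_type A)) (decl \<psi> (nth_type A \<circ> fst \<circ> prod_decode)) (Rep_trm t') A"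
    by (auto simp: typable_def)
  have "fv t' \<subseteq> range \<phi>" "fmv t' \<subseteq> range \<psi>"
    using ptyping_free_names[OF t'(2)] unfolding decl_dom fv.rep_eq fmv.rep_eq by auto
  then have "closed_trm t'"
    using reds_free_names[OF t'(1)] \<phi>(2) \<psi>(2) unfolding closed_trm_def by blast
  with t' ptyping_imp_typing_closed show ?thesis by blast
qed

theorem theorem3p10:
  fixes A :: "('p :: infinite) ty"
    and t :: "('x :: infinite, 'm :: infinite) trm"
  shows "t \<in> sem A \<longleftrightarrow>
    (\<exists>t'. closed_trm t' \<and> t \<triangleright>\<^sup>* t' \<and> (Map.empty \<turnstile> t' : A ; Map.empty))"
proof
  assume "\<exists>t'. closed_trm t' \<and> t \<triangleright>\<^sup>* t' \<and> (Map.empty \<turnstile> t' : A ; Map.empty)"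
  then show "t \<in> sem A"
    using typing_imp_sem sem_saturated[of A] unfolding saturated_def by blast
qed (rule sem_imp_typing)

end
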